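(* Let $f\in C^{\infty}_{W,V}([0,1])$ be a function such that for every $n\ge 0$ $$\max\left\{\|D^{(2n)}_{W,V}f\|_{\infty},\ \|D^{(2n+1)}_{W,V}f\|_{\infty}\right\}\le c_{n},$$ where $\|\cdot\|_\infty$ is the sup-norm on $[0,1]$ and $c_{n}=o\left(\frac{n!}{e^{n}}\right)$ as $n\to\infty$. Then $$f(x)=f(0)+\sum_{k=1}^{\infty}\left[D^{(k)}_{W,V}f(0)\right]F_{k}(x,x),$$ and the convergence of the series is uniform over $x\in[0,1]$. Moreover, in order for $f$ and all $D^{(n)}_{W,V}f$ to be well defined on $\mathbb{T}$ (i.e. to take equal values at $0$ and $1$), the following equations must be satisfied: for every even integer $m\ge 0$, $$\sum_{k=1}^{\infty} D^{(k+m)}_{W,V}f(0)\,F_{k}(1,1)=0,$$ and for every odd integer $m\ge 1$, $$\sum_{k=1}^{\infty} D^{(k+m)}_{W,V}f(0)\,G_{k}(1,1)=0.$$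
   Context: $W,V:\mathbb{R}\to\mathbb{R}$ are strictly increasing, $W$ is càdlàg (right-continuous with left limits), $V$ is càglàd (left-continuous with right limits), $W(x+1)-W(x)=W(1)-W(0)$ and $V(x+1)-V(x)=V(1)-V(0)$ for all $x$, both are continuous at $0$ and $W(0)=V(0)=0$. Both may have (possibly dense) jumps. $\mathbb{T}=\mathbb{R}/\mathbb{Z}$. The measures $dW,dV$ are determined by $dW((a,b])=W(b)-W(a)$, $dV([a,b))=V(b)-V(a)$. One-sided derivatives: $D^{-}_{W}f(x)=\lim_{h\to0^-}\frac{f(x+h)-f(x)}{W(x+h)-W(x)}$ and $D^{+}_{V}g(x)=\lim_{h\to0^+}\frac{g(x+h)-g(x)}{V(x+h)-V(x)}$. Set $D^{(0)}_{W,V}f=f$, and let $D^{(n)}_{W,V}$ be the alternating composition of $n$ one-sided derivatives, starting (innermost) with $D^-_W$: $D^{(1)}_{W,V}=D^-_W$, $D^{(2)}_{W,V}=D^+_VD^-_W$, $D^{(3)}_{W,V}=D^-_WD^+_VD^-_W$, etc. $C^{\infty}_{W,V}([0,1])$ is the set of (restrictions to $[0,1]$ of) functions $f$ on an open interval containing $[0,1]$ such that $D^{(n)}_{W,V}f$ exists everywhere for all $n\ge0$, is càdlàg for $n$ even and càglàd for $n$ odd. For $0\le s\le x\le 1$: $F_1(x,s)=W(s)$, $G_1(x,s)=V(s)$, and for $n\ge2$ $$F_{n}(x,s)=\int_{[0,s)}[F_{n-1}(x,x)-F_{n-1}(x,\xi)]\,dV(\xi)\ (n\text{ even}),\qquad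 F_{n}(x,s)=\int_{(0,s]}[F_{n-1}(x,x)-F_{n-1}(x,\xi)]\,dW(\xi)\ (n\text{ odd}),$$ $$G_{n}(x,s)=\int_{(0,s]}[G_{n-1}(x,x)-G_{n-1}(x,\xi)]\,dW(\xi)\ (n\text{ even}),\qquad G_{n}(x,s)=\int_{[0,s)}[G_{n-1}(x,x)-G_{n-1}(x,\xi)]\,dV(\xi)\ (n\text{ odd}).$$ *)

theory Defs
  imports "HOL-Analysis.Analysis" "HOL-Library.Landau_Symbols"
begin

definition cadlag_on :: "real set \<Rightarrow> (real \<Rightarrow> real) \<Rightarrow> bool" where
  "cadlag_on A g \<longleftrightarrow> (\<forall>x\<in>A. continuous (at_right x) g \<and> (\<exists>l. (g \<longlongrightarrow> l) (at_left x)))"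

definition caglad_on :: "real set \<Rightarrow> (real \<Rightarrow> real) \<Rightarrow> bool" where
  "caglad_on A g \<longleftrightarrow> (\<forall>x\<in>A. continuous (at_left x) g \<and> (\<exists>l. (g \<longlongrightarrow> l) (at_right x)))"

definition has_left_deriv :: "(real \<Rightarrow> real) \<Rightarrow> (real \<Rightarrow> real) \<Rightarrow> real \<Rightarrow> real \<Rightarrow> bool" where
  "has_left_deriv W f x d \<longleftrightarrow>
     ((\<lambda>h. (f (x + h) - f x) / (W (x + h) - W x)) \<longlongrightarrow> d) (at_left 0)"

definition has_right_deriv :: "(real \<Rightarrow> real) \<Rightarrow> (real \<Rightarrow> real) \<Rightarrow> real \<Rightarrow> real \<Rightarrow> bool" where
  "has_right_deriv V g x d \<longleftrightarrow>
     ((\<lambda>h. (g (x + h) - g x) / (V (x + h) - V x)) \<longlongrightarrow> d) (at_right 0)"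

text \<open>The two derivative operators carry no information at points where the limit does not
  exist; existence is required separately in \<open>C_infinity\<close>.\<close>

definition left_deriv :: "(real \<Rightarrow> real) \<Rightarrow> (real \<Rightarrow> real) \<Rightarrow> real \<Rightarrow> real" where
  "left_deriv W f x = (THE d. has_left_deriv W f x d)"

definition right_deriv :: "(real \<Rightarrow> real) \<Rightarrow> (real \<Rightarrow> real) \<Rightarrow> real \<Rightarrow> real" where
  "right_deriv V g x = (THE d. has_right_deriv V g x d)"

lemma left_deriv_eq: "has_left_deriv W f x d \<Longrightarrow> left_deriv W f x = d"
  unfolding left_deriv_def has_left_deriv_def
  by (rule the_equality) (auto intro: tendsto_unique[OF trivial_limit_at_left_real])

lemma right_deriv_eq: "has_right_deriv V g x d \<Longrightarrow> right_deriv V g x = d"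
  unfolding right_deriv_def has_right_deriv_def
  by (rule the_equality) (auto intro: tendsto_unique[OF trivial_limit_at_right_real])

primrec D :: "(real \<Rightarrow> real) \<Rightarrow> (real \<Rightarrow> real) \<Rightarrow> nat \<Rightarrow> (real \<Rightarrow> real) \<Rightarrow> real \<Rightarrow> real" where
  "D W V 0 f = f"
| "D W V (Suc n) f = (if even n then left_deriv W (D W V n f) else right_deriv V (D W V n f))"

text \<open>A member of \<open>C_infinity W V\<close> is a total function that serves as the extension of its
  restriction to \<open>{0..1}\<close> to the open interval \<open>{a<..<b}\<close>. Its values off that interval are
  irrelevant, since one-sided derivatives at points of the interval are local.\<close>

definition C_infinity :: "(real \<Rightarrow> real) \<Rightarrow> (real \<Rightarrow> real) \<Rightarrow> (real \<Rightarrow> real) set" where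
  "C_infinity W V = {f. \<exists>a b. a < 0 \<and> 1 < b \<and>
     (\<forall>n. \<forall>x\<in>{a<..<b}.
        if even n then \<exists>d. has_left_deriv W (D W V n f) x d
        else \<exists>d. has_right_deriv V (D W V n f) x d) \<and>
     (\<forall>n. if even n then cadlag_on {a<..<b} (D W V n f) else caglad_on {a<..<b} (D W V n f))}"

definition sup_norm :: "(real \<Rightarrow> real) \<Rightarrow> ereal" where
  "sup_norm g = (SUP x\<in>{0..1}. ereal \<bar>g x\<bar>)"

text \<open>The library constructs Stieltjes measures from right-continuous functions. For the
  left-continuous \<open>V\<close> we reflect: \<open>\<lambda>x. - V (- x)\<close> is right-continuous, and the image of its
  measure under \<open>uminus\<close> gives \<open>{a..<b}\<close> the mass \<open>V b - V a\<close>.\<close>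

definition dW :: "(real \<Rightarrow> real) \<Rightarrow> real measure" where
  "dW W = interval_measure W"

definition dV :: "(real \<Rightarrow> real) \<Rightarrow> real measure" where
  "dV V = distr (interval_measure (\<lambda>x. - V (- x))) borel uminus"

lemma emeasure_dW_Ioc:
  assumes "strict_mono W" "cadlag_on UNIV W" "a \<le> b"
  shows "emeasure (dW W) {a<..b} = ennreal (W b - W a)"
  unfolding dW_def
  by (rule emeasure_interval_measure_Ioc)
     (use assms in \<open>auto simp: cadlag_on_def strict_mono_less_eq\<close>)

lemma emeasure_dV_Ico:
  assumes "strict_mono V" "caglad_on UNIV V" "a \<le> b"
  shows "emeasure (dV V) {a..<b} = ennreal (V b - V a)"
proof -
  let ?U = "\<lambda>x. - V (- x)"
  have cont: "continuous (at_right x) ?U" for x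
  proof -
    have "(V \<longlongrightarrow> V (- x)) (at_left (- x))"
      using assms(2) by (simp add: caglad_on_def continuous_within)
    hence "((\<lambda>y. V (- y)) \<longlongrightarrow> V (- x)) (at_right x)"
      by (simp add: filterlim_at_left_to_right)
    thus ?thesis by (simp add: continuous_within tendsto_minus)
  qed
  have "emeasure (dV V) {a..<b} = emeasure (interval_measure ?U) (uminus -` {a..<b} \<inter> UNIV)"
    unfolding dV_def by (subst emeasure_distr) auto
  also have "uminus -` {a..<b} \<inter> UNIV = {- b<..- a}" by auto
  also have "emeasure (interval_measure ?U) {- b<..- a} = ennreal (?U (- a) - ?U (- b))"
    by (rule emeasure_interval_measure_Ioc)
       (use assms cont in \<open>auto simp: strict_mono_less_eq\<close>)
  finally show ?thesis by simp
qed

text \<open>The families \<open>F\<close> and \<open>G\<close> are indexed from \<open>1\<close>; the value at index \<open>0\<close> is a placeholder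
  that nothing refers to. In the last clause of each, \<open>even n\<close> is the parity of the index
  \<open>Suc (Suc n)\<close>.\<close>

fun F :: "(real \<Rightarrow> real) \<Rightarrow> (real \<Rightarrow> real) \<Rightarrow> nat \<Rightarrow> real \<Rightarrow> real \<Rightarrow> real" where
  "F W V 0 x s = 0"
| "F W V (Suc 0) x s = W s"
| "F W V (Suc (Suc n)) x s =
     (if even n
      then LINT \<xi>:{0..<s}|dV V. F W V (Suc n) x x - F W V (Suc n) x \<xi>
      else LINT \<xi>:{0<..s}|dW W. F W V (Suc n) x x - F W V (Suc n) x \<xi>)"

fun G :: "(real \<Rightarrow> real) \<Rightarrow> (real \<Rightarrow> real) \<Rightarrow> nat \<Rightarrow> real \<Rightarrow> real \<Rightarrow> real" where
  "G W V 0 x s = 0"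
| "G W V (Suc 0) x s = V s"
| "G W V (Suc (Suc n)) x s =
     (if even n
      then LINT \<xi>:{0<..s}|dW W. G W V (Suc n) x x - G W V (Suc n) x \<xi>
      else LINT \<xi>:{0..<s}|dV V. G W V (Suc n) x x - G W V (Suc n) x \<xi>)"

end

theory Submission
  imports Defs
begin

text \<open>The expansion is a Taylor formula. A fundamental theorem of calculus
  (\<open>ftc_left_deriv\<close>, \<open>ftc_right_deriv\<close>) turns the differential relations between the successive
  derivatives of \<open>f\<close> into integral ones: with \<open>d n\<close> the \<open>n\<close>-th derivative,
  \<open>d n x - d n 0\<close> is the integral of \<open>d (Suc n)\<close> over \<open>{0<..x}\<close> against \<open>dW\<close> for even \<open>n\<close>, and
  over \<open>{0..<x}\<close> against \<open>dV\<close> for odd \<open>n\<close>. Substituting these relations into each other \<open>N\<close> times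
  (\<open>taylor\<close>) writes \<open>d m\<close> as a sum of the numbers \<open>d (m + k) 0\<close>, each multiplied by the
  \<open>k\<close>-fold iterated integral of \<open>1\<close>, plus the \<open>N\<close>-fold iterated integral of \<open>d (m + N)\<close>.

  In these iterated integrals the innermost variable is integrated first, whereas \<open>F\<close> and \<open>G\<close> keep
  \<open>x\<close> fixed and integrate the outermost variable first. Fubini's theorem identifies the two
  (\<open>iter_eq_kernel\<close>, \<open>F_eq_integral_kernel\<close>, \<open>G_eq_integral_kernel\<close>): the difference
  \<open>F W V n x x - F W V n x s\<close> is the kernel through which \<open>n + 1\<close> integrations, evaluated at \<open>x\<close>,
  act on the value of a function at \<open>s\<close>.

  The remainder vanishes because \<open>2 n\<close> alternating integrations gain \<open>(fact n)\<^sup>2\<close>. The variables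
  of such an integral interlace as \<open>\<xi>\<^sub>1 > \<eta>\<^sub>1 \<ge> \<xi>\<^sub>2 > \<eta>\<^sub>2 \<ge> \<dots>\<close>, so the \<open>\<xi>\<close>s and the \<open>\<eta>\<close>s are each
  strictly decreasing; forgetting the interlacing bounds the integral by the product of the masses
  of two strictly ordered simplices, and each is at most a total mass to the power \<open>n\<close> divided by
  \<open>fact n\<close>, atoms included (\<open>simplex_mass_le\<close>). Against derivatives of size \<open>o(n! / e\<^sup>n)\<close> the
  remainder is therefore of size \<open>C\<^sup>n / n!\<close>, uniformly in \<open>x\<close>. The conditions for \<open>f\<close> to live on the circle
  are the same expansion of \<open>d m\<close>, read at \<open>x = 1\<close> where \<open>d m 1 = d m 0\<close>.\<close>

section \<open>A fundamental theorem of calculus for Stieltjes derivatives\<close>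

text \<open>A mean value principle without differentiability. The infimum of the points where
  \<open>u\<close> is at most \<open>u b\<close> is attained by right-continuity, and the local hypothesis would push it further
  left if it were not \<open>a\<close>.\<close>

lemma le_of_local_left_le:
  fixes u :: "real \<Rightarrow> real"
  assumes "a \<le> b"
    and rc: "\<And>x. a \<le> x \<Longrightarrow> x < b \<Longrightarrow> continuous (at_right x) u"
    and loc: "\<And>x. a < x \<Longrightarrow> x \<le> b \<Longrightarrow> eventually (\<lambda>y. u y \<le> u x) (at_left x)"
  shows "u a \<le> u b"
proof -
  define S where "S = {x\<in>{a..b}. u x \<le> u b}"
  have bS: "b \<in> S" using \<open>a \<le> b\<close> by (auto simp: S_def)
  have bdd: "bdd_below S" by (auto simp: S_def)
  define x0 where "x0 = Inf S"
  have ax0: "a \<le> x0" unfolding x0_def using bS by (intro cInf_greatest) (auto simp: S_def)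
  have x0b: "x0 \<le> b" unfolding x0_def using bS bdd by (rule cInf_lower)
  have x0S: "u x0 \<le> u b"
  proof (rule ccontr)
    assume neg: "\<not> u x0 \<le> u b"
    then have "x0 < b" using x0b by (cases "x0 = b") auto
    then have "(u \<longlongrightarrow> u x0) (at_right x0)"
      using rc[of x0] ax0 by (simp add: continuous_within)
    then have "eventually (\<lambda>y. u b < u y) (at_right x0)"
      using neg by (intro order_tendstoD) auto
    then obtain c where c: "x0 < c" "\<And>y. x0 < y \<Longrightarrow> y < c \<Longrightarrow> u b < u y"
      unfolding eventually_at_right_field by auto
    obtain s where "s \<in> S" "s < c"
      using cInf_lessD[of S c] bS c(1) unfolding x0_def by auto
    moreover have "x0 \<le> s" unfolding x0_def using \<open>s \<in> S\<close> bdd by (rule cInf_lower)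
    ultimately show False using c(2)[of s] neg by (cases "s = x0") (auto simp: S_def)
  qed
  have "\<not> a < x0"
  proof
    assume "a < x0"
    then obtain c where c: "c < x0" "\<And>y. c < y \<Longrightarrow> y < x0 \<Longrightarrow> u y \<le> u x0"
      using loc[of x0] x0b unfolding eventually_at_left_field by auto
    define y where "y = (max a c + x0) / 2"
    have y: "a < y" "c < y" "y < x0" using \<open>a < x0\<close> c(1) by (auto simp: y_def)
    then have "y \<in> S" using c(2)[of y] x0S x0b by (auto simp: S_def)
    then have "x0 \<le> y" unfolding x0_def using bdd by (rule cInf_lower)
    then show False using y by simp
  qed
  then show ?thesis using ax0 x0S by simp
qed

lemma has_left_deriv_iff:
  "has_left_deriv W f x d \<longleftrightarrow> ((\<lambda>y. (f y - f x) / (W y - W x)) \<longlongrightarrow> d) (at_left x)"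
  unfolding has_left_deriv_def
  by (subst at_left_to_0) (simp add: filterlim_filtermap add.commute)

context
  fixes U :: "real \<Rightarrow> real"
  assumes mono: "strict_mono U" and rc: "\<And>x. continuous (at_right x) U"
begin

lemma emeasure_Ioc: "a \<le> b \<Longrightarrow> emeasure (interval_measure U) {a<..b} = ennreal (U b - U a)"
  by (rule emeasure_interval_measure_Ioc) (use mono rc in \<open>auto simp: strict_mono_less_eq\<close>)

lemma measure_Ioc: "a \<le> b \<Longrightarrow> measure (interval_measure U) {a<..b} = U b - U a"
  using emeasure_Ioc[of a b] mono by (simp add: measure_def strict_mono_less_eq)

lemma integrable_Ioc:
  assumes "g \<in> borel_measurable borel" "\<And>x. \<bar>g x\<bar> \<le> (C::real)"
  shows "set_integrable (interval_measure U) {a<..b} g"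
  unfolding set_integrable_def
proof (rule integrableI_bounded_set_indicator[where B = C])
  show "emeasure (interval_measure U) {a<..b} < \<infinity>"
    using emeasure_Ioc[of a b] by (cases "a \<le> b") auto
qed (use assms in auto)

text \<open>The integral \<open>H\<close> of \<open>g\<close> has left derivative \<open>g\<close> with respect to \<open>U\<close>, because \<open>g\<close> is
  left-continuous and \<open>H x - H y\<close> sees only the values of \<open>g\<close> on \<open>{y<..x}\<close>; an atom at \<open>x\<close> contributes
  exactly \<open>g x\<close> times its mass. Hence \<open>f - H\<close> has left derivative \<open>0\<close>. The mean value principle,
  applied to \<open>\<plusminus>(f - H) + \<epsilon> U\<close>, bounds the increment of \<open>f - H\<close> by \<open>\<epsilon> (U b - U a)\<close>.\<close>

lemma ftc_left_deriv:
  assumes "a \<le> b"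
    and g: "g \<in> borel_measurable borel" "\<And>x. \<bar>g x\<bar> \<le> (C::real)"
    and rcf: "\<And>x. a \<le> x \<Longrightarrow> x < b \<Longrightarrow> continuous (at_right x) f"
    and lcg: "\<And>x. a < x \<Longrightarrow> x \<le> b \<Longrightarrow> continuous (at_left x) g"
    and der: "\<And>x. a < x \<Longrightarrow> x \<le> b \<Longrightarrow> has_left_deriv U f x (g x)"
  shows "f b - f a = (LINT \<xi>:{a<..b}|interval_measure U. g \<xi>)"
proof -
  define H where "H x = (LINT \<xi>:{a<..x}|interval_measure U. g \<xi>)" for x
  note int = integrable_Ioc[OF g]
  have intc: "set_integrable (interval_measure U) {p<..q} (\<lambda>_. c)" for p q and c :: real
    by (rule integrable_Ioc[where C = "\<bar>c\<bar>"]) auto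
  have const: "(LINT \<xi>:{p<..q}|interval_measure U. c) = (U q - U p) * c" if "p \<le> q" for p q c :: real
    using emeasure_Ioc[OF that] measure_Ioc[OF that] by (subst set_integral_const) auto
  have H_diff: "H q - H p = (LINT \<xi>:{p<..q}|interval_measure U. g \<xi>)" if "a \<le> p" "p \<le> q" for p q
  proof -
    have "{a<..q} = {a<..p} \<union> {p<..q}" "{a<..p} \<inter> {p<..q} = {}" using that by auto
    then show ?thesis unfolding H_def using int by (simp add: set_integral_Un)
  qed
  have H_near: "\<bar>H q - H p - c * (U q - U p)\<bar> \<le> e * (U q - U p)"
    if "a \<le> p" "p \<le> q" "\<And>\<xi>. p < \<xi> \<Longrightarrow> \<xi> \<le> q \<Longrightarrow> \<bar>g \<xi> - c\<bar> \<le> e" for p q c e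
  proof -
    have "(LINT \<xi>:{p<..q}|interval_measure U. c - e) \<le> H q - H p"
      unfolding H_diff[OF that(1,2)] using that(3)
      by (intro set_integral_mono int intc) (auto simp: abs_le_iff algebra_simps)
    then have ge: "(U q - U p) * (c - e) \<le> H q - H p" using const[OF that(2)] by simp
    have "H q - H p \<le> (LINT \<xi>:{p<..q}|interval_measure U. c + e)"
      unfolding H_diff[OF that(1,2)] using that(3)
      by (intro set_integral_mono int intc) (auto simp: abs_le_iff algebra_simps)
    then have le: "H q - H p \<le> (U q - U p) * (c + e)" using const[OF that(2)] by simp
    show ?thesis using ge le by (simp add: algebra_simps abs_le_iff)
  qed
  have rcH: "continuous (at_right x) H" if "a \<le> x" for x
  proof -
    have "((\<lambda>y. H y - H x) \<longlongrightarrow> 0) (at_right x)"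
    proof (rule Lim_null_comparison)
      show "eventually (\<lambda>y. norm (H y - H x) \<le> C * (U y - U x)) (at_right x)"
        unfolding eventually_at_right_field
        using H_near[of x _ 0 C] that g(2) by (intro exI[of _ "x + 1"]) auto
      have "((\<lambda>y. C * (U y - U x)) \<longlongrightarrow> C * (U x - U x)) (at_right x)"
        using rc[of x] by (intro tendsto_intros) (simp add: continuous_within)
      then show "((\<lambda>y. C * (U y - U x)) \<longlongrightarrow> 0) (at_right x)" by simp
    qed
    then show ?thesis by (simp add: continuous_within LIM_zero_iff)
  qed
  define u where "u x = f x - H x" for x
  have u_local: "eventually (\<lambda>y. \<bar>u x - u y\<bar> \<le> e * (U x - U y)) (at_left x)"
    if x: "a < x" "x \<le> b" and "e > 0" for x e
  proof -
    have "eventually (\<lambda>y. \<bar>(f y - f x) / (U y - U x) - g x\<bar> < e/2) (at_left x)"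
      using tendstoD[OF der[OF x, unfolded has_left_deriv_iff], of "e/2"] \<open>e > 0\<close>
      by (simp add: dist_real_def)
    moreover have "eventually (\<lambda>\<xi>. \<bar>g \<xi> - g x\<bar> < e/2) (at_left x)"
      using lcg[OF x] tendstoD[of g "g x" "at_left x" "e/2"] \<open>e > 0\<close>
      by (simp add: dist_real_def continuous_within)
    ultimately have "eventually (\<lambda>y. \<bar>(f y - f x) / (U y - U x) - g x\<bar> < e/2 \<and> \<bar>g y - g x\<bar> < e/2) (at_left x)"
      by eventually_elim simp
    then obtain l where l: "l < x" and
      l1: "\<And>y. l < y \<Longrightarrow> y < x \<Longrightarrow> \<bar>(f y - f x) / (U y - U x) - g x\<bar> < e/2" and
      l2: "\<And>y. l < y \<Longrightarrow> y < x \<Longrightarrow> \<bar>g y - g x\<bar> < e/2"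
      unfolding eventually_at_left_field by blast
    have "\<bar>u x - u y\<bar> \<le> e * (U x - U y)" if y: "max a l < y" "y < x" for y
    proof -
      have pos: "0 < U x - U y" using mono y by (simp add: strict_mono_less)
      have "\<bar>g \<xi> - g x\<bar> \<le> e/2" if "y < \<xi>" "\<xi> \<le> x" for \<xi>
        using l2[of \<xi>] that y \<open>e > 0\<close> by (cases "\<xi> = x") auto
      then have 1: "\<bar>H x - H y - g x * (U x - U y)\<bar> \<le> e/2 * (U x - U y)"
        using y by (intro H_near) auto
      have "(f y - f x) / (U y - U x) = (f x - f y) / (U x - U y)"
        by (metis minus_diff_eq minus_divide_divide)
      moreover have "(f x - f y) - g x * (U x - U y) = ((f x - f y) / (U x - U y) - g x) * (U x - U y)"
        using pos by (simp add: field_simps)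
      ultimately have "\<bar>(f x - f y) - g x * (U x - U y)\<bar> = \<bar>(f y - f x) / (U y - U x) - g x\<bar> * (U x - U y)"
        using pos by (simp only: abs_mult abs_of_pos)
      also have "\<dots> \<le> e/2 * (U x - U y)"
        using l1[of y] y pos by (intro mult_right_mono) auto
      finally have 2: "\<bar>(f x - f y) - g x * (U x - U y)\<bar> \<le> e/2 * (U x - U y)" .
      have "\<bar>u x - u y\<bar> = \<bar>((f x - f y) - g x * (U x - U y)) - (H x - H y - g x * (U x - U y))\<bar>"
        by (simp add: u_def)
      also have "\<dots> \<le> e/2 * (U x - U y) + e/2 * (U x - U y)"
        by (intro order_trans[OF abs_triangle_ineq4] add_mono 1 2)
      finally show ?thesis by simp
    qed
    then show ?thesis unfolding eventually_at_left_field using l x by (intro exI[of _ "max a l"]) auto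
  qed
  have bound: "\<bar>u b - u a\<bar> \<le> e * (U b - U a)" if "e > 0" for e
  proof -
    have "s * u a + e * U a \<le> s * u b + e * U b" if s: "\<bar>s\<bar> = 1" for s :: real
    proof (rule le_of_local_left_le[OF \<open>a \<le> b\<close>, where u = "\<lambda>x. s * u x + e * U x"])
      show "continuous (at_right x) (\<lambda>x. s * u x + e * U x)" if "a \<le> x" "x < b" for x
        unfolding u_def using that rc rcf rcH by (intro continuous_intros) auto
      show "eventually (\<lambda>y. s * u y + e * U y \<le> s * u x + e * U x) (at_left x)" if "a < x" "x \<le> b" for x
        using u_local[OF that \<open>e > 0\<close>]
      proof eventually_elim
        case (elim y)
        have "s * (u y - u x) \<le> \<bar>u x - u y\<bar>" using s by (cases "s \<ge> 0") (auto simp: abs_if split: if_splits)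
        then show ?case using elim by (simp add: algebra_simps)
      qed
    qed
    from this[of 1] this[of "-1"] show ?thesis by (simp add: algebra_simps abs_le_iff)
  qed
  have "\<bar>u b - u a\<bar> \<le> 0"
  proof (rule field_le_epsilon)
    fix e :: real assume "e > 0"
    have K: "0 \<le> U b - U a" using mono \<open>a \<le> b\<close> by (simp add: strict_mono_less_eq)
    \<comment> \<open>Adding 1 to the denominator covers the case \<open>a = b\<close>.\<close>
    have "\<bar>u b - u a\<bar> \<le> e / (U b - U a + 1) * (U b - U a)" using \<open>e > 0\<close> K by (intro bound) auto
    also have "\<dots> \<le> e" using \<open>e > 0\<close> K by (simp add: field_simps)
    finally show "\<bar>u b - u a\<bar> \<le> 0 + e" by simp
  qed
  moreover have "H a = 0" unfolding H_def by (simp add: set_lebesgue_integral_def)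
  ultimately show ?thesis unfolding u_def H_def[symmetric] by simp
qed

end

lemma continuous_at_right_reflect:
  fixes f :: "real \<Rightarrow> real"
  shows "continuous (at_right x) (\<lambda>y. f (- y)) \<longleftrightarrow> continuous (at_left (- x)) f"
  by (simp add: continuous_within filterlim_at_left_to_right)

lemma continuous_at_left_reflect:
  fixes f :: "real \<Rightarrow> real"
  shows "continuous (at_left x) (\<lambda>y. f (- y)) \<longleftrightarrow> continuous (at_right (- x)) f"
  by (simp add: continuous_within filterlim_at_left_to_right)

text \<open>The reflection \<open>x \<mapsto> - x\<close> exchanges left and right and maps the measure of \<open>V\<close> to the
  Stieltjes measure of the right-continuous function \<open>\<lambda>x. - V (- x)\<close>.\<close>

lemma ftc_right_deriv:
  assumes V: "strict_mono V" "\<And>x. continuous (at_left x) V"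
    and "a \<le> b"
    and g: "g \<in> borel_measurable borel" "\<And>x. \<bar>g x\<bar> \<le> (C::real)"
    and lcf: "\<And>x. a < x \<Longrightarrow> x \<le> b \<Longrightarrow> continuous (at_left x) f"
    and rcg: "\<And>x. a \<le> x \<Longrightarrow> x < b \<Longrightarrow> continuous (at_right x) g"
    and der: "\<And>x. a \<le> x \<Longrightarrow> x < b \<Longrightarrow> has_right_deriv V f x (g x)"
  shows "f b - f a = (LINT \<xi>:{a..<b}|dV V. g \<xi>)"
proof -
  note [measurable] = g(1)
  let ?U = "\<lambda>x. - V (- x)"
  have "- f (- (- a)) - (- f (- (- b))) = (LINT \<xi>:{- b<..- a}|interval_measure ?U. g (- \<xi>))"
  proof (rule ftc_left_deriv[where C = C and f = "\<lambda>x. - f (- x)"])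
    show "strict_mono ?U" using V(1) by (simp add: strict_mono_def)
    show "continuous (at_right x) ?U" for x
      by (intro continuous_minus) (simp add: continuous_at_right_reflect V)
    show "(\<lambda>x. g (- x)) \<in> borel_measurable borel" by measurable
    show "continuous (at_right x) (\<lambda>x. - f (- x))" if "- b \<le> x" "x < - a" for x
      using that by (intro continuous_minus) (simp add: continuous_at_right_reflect lcf)
    show "continuous (at_left x) (\<lambda>x. g (- x))" if "- b < x" "x \<le> - a" for x
      using that by (simp add: continuous_at_left_reflect rcg)
    show "has_left_deriv ?U (\<lambda>x. - f (- x)) x (g (- x))" if "- b < x" "x \<le> - a" for x
    proof -
      have "((\<lambda>h. (f (- x + h) - f (- x)) / (V (- x + h) - V (- x))) \<longlongrightarrow> g (- x)) (at_right 0)"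
        using der[of "- x"] that by (simp add: has_right_deriv_def)
      moreover have "(f (- x + h) - f (- x)) / (V (- x + h) - V (- x))
          = (- f (- (x - h)) - - f (- x)) / (- V (- (x - h)) - - V (- x))" for h
        using minus_divide_divide[of "f (- x + h) - f (- x)" "V (- x + h) - V (- x)"]
        by (simp add: algebra_simps)
      ultimately show ?thesis
        unfolding has_left_deriv_def filterlim_at_left_to_right by simp
    qed
  qed (use \<open>a \<le> b\<close> g in auto)
  also have "\<dots> = (LINT \<xi>:{a..<b}|dV V. g \<xi>)"
    unfolding set_lebesgue_integral_def dV_def
    by (subst integral_distr) (auto intro!: Bochner_Integration.integral_cong simp: indicator_def)
  finally show ?thesis by simp
qed


section \<open>Mass of strictly ordered simplices\<close>

text \<open>The \<open>\<mu>\<close>-mass of the tuples \<open>x > \<xi>\<^sub>1 > \<dots> > \<xi>\<^sub>n\<close>.\<close>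

primrec simplex_mass :: "real measure \<Rightarrow> nat \<Rightarrow> real \<Rightarrow> ennreal" where
  "simplex_mass \<mu> 0 x = 1"
| "simplex_mass \<mu> (Suc n) x = (\<integral>\<^sup>+\<xi>. (if \<xi> < x then simplex_mass \<mu> n \<xi> else 0) \<partial>\<mu>)"

lemma measurable_simplex_mass:
  assumes "sigma_finite_measure \<mu>" and [measurable_cong]: "sets \<mu> = sets borel"
  shows "simplex_mass \<mu> n \<in> borel_measurable borel"
proof (induction n)
  case 0
  have "simplex_mass \<mu> 0 = (\<lambda>x. 1)" by auto
  then show ?case by simp
next
  case (Suc n)
  note [measurable] = Suc
  interpret sigma_finite_measure \<mu> by fact
  have "(\<lambda>x. \<integral>\<^sup>+\<xi>. (if \<xi> < x then simplex_mass \<mu> n \<xi> else 0) \<partial>\<mu>) \<in> borel_measurable borel"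
    by measurable
  then show ?case by (simp add: simplex_mass.simps(2)[abs_def])
qed

lemma simplex_mass_mono: "x \<le> y \<Longrightarrow> simplex_mass \<mu> n x \<le> simplex_mass \<mu> n y"
  by (cases n) (auto intro!: nn_integral_mono)

text \<open>Inserting one more point below \<open>x\<close> into a strictly decreasing \<open>n\<close>-tuple: up to ties,
  the new point takes one of \<open>n + 1\<close> positions and the results are all \<open>(n + 1)\<close>-tuples. Ties, that is
  atoms of \<open>\<mu>\<close>, only enlarge the right-hand side. The induction peels off the largest entry \<open>b\<close> of the
  tuple and compares it with the new point \<open>a\<close>.\<close>

lemma simplex_mass_shuffle:
  assumes "sigma_finite_measure \<mu>" and [measurable_cong]: "sets \<mu> = sets borel"
  shows "of_nat (Suc n) * simplex_mass \<mu> (Suc n) x \<le> simplex_mass \<mu> 1 x * simplex_mass \<mu> n x"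
proof (induction n arbitrary: x)
  case 0
  then show ?case by simp
next
  case (Suc n)
  interpret sigma_finite_measure \<mu> by fact
  interpret P: pair_sigma_finite \<mu> \<mu> ..
  note [measurable] = measurable_simplex_mass[OF assms]
  have one: "simplex_mass \<mu> 1 b = (\<integral>\<^sup>+a. (if a < b then 1 else 0) \<partial>\<mu>)" for b
    by (simp cong: if_cong)
  have "(\<integral>\<^sup>+b. (if b < x then of_nat (Suc n) * simplex_mass \<mu> (Suc n) b else 0) \<partial>\<mu>)
      = (\<integral>\<^sup>+b. of_nat (Suc n) * (if b < x then simplex_mass \<mu> (Suc n) b else 0) \<partial>\<mu>)"
    by (intro nn_integral_cong) simp
  also have "\<dots> = of_nat (Suc n) * simplex_mass \<mu> (Suc (Suc n)) x"
    unfolding simplex_mass.simps(2)[of _ "Suc n"] by (rule nn_integral_cmult) measurable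
  finally have "of_nat (Suc (Suc n)) * simplex_mass \<mu> (Suc (Suc n)) x
      = (\<integral>\<^sup>+b. (if b < x then of_nat (Suc n) * simplex_mass \<mu> (Suc n) b else 0) \<partial>\<mu>) + simplex_mass \<mu> (Suc (Suc n)) x"
    by (simp add: algebra_simps del: simplex_mass.simps)
  also have "\<dots> \<le> (\<integral>\<^sup>+b. (if b < x then simplex_mass \<mu> 1 b * simplex_mass \<mu> n b else 0) \<partial>\<mu>) + simplex_mass \<mu> (Suc (Suc n)) x"
    using Suc by (intro add_mono nn_integral_mono) (auto simp del: simplex_mass.simps)
  also have "(\<integral>\<^sup>+b. (if b < x then simplex_mass \<mu> 1 b * simplex_mass \<mu> n b else 0) \<partial>\<mu>)
      = (\<integral>\<^sup>+b. (\<integral>\<^sup>+a. (if a < b \<and> b < x then simplex_mass \<mu> n b else 0) \<partial>\<mu>) \<partial>\<mu>)"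
    unfolding one
    by (intro nn_integral_cong) (auto simp: nn_integral_multc[symmetric] intro!: nn_integral_cong)
  also have "\<dots> = (\<integral>\<^sup>+a. (\<integral>\<^sup>+b. (if a < b \<and> b < x then simplex_mass \<mu> n b else 0) \<partial>\<mu>) \<partial>\<mu>)"
    by (rule P.Fubini') measurable
  also have "\<dots> + simplex_mass \<mu> (Suc (Suc n)) x
      = (\<integral>\<^sup>+a. (\<integral>\<^sup>+b. (if a < b \<and> b < x then simplex_mass \<mu> n b else 0) \<partial>\<mu>)
          + (\<integral>\<^sup>+b. (if b < a \<and> a < x then simplex_mass \<mu> n b else 0) \<partial>\<mu>) \<partial>\<mu>)"
  proof -
    have "simplex_mass \<mu> (Suc (Suc n)) x
        = (\<integral>\<^sup>+a. (\<integral>\<^sup>+b. (if b < a \<and> a < x then simplex_mass \<mu> n b else 0) \<partial>\<mu>) \<partial>\<mu>)"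
      by (auto intro!: nn_integral_cong)
    then show ?thesis by (simp only:) (rule nn_integral_add[symmetric]; measurable)
  qed
  also have "\<dots> = (\<integral>\<^sup>+a. (\<integral>\<^sup>+b. (if a < b \<and> b < x then simplex_mass \<mu> n b else 0)
            + (if b < a \<and> a < x then simplex_mass \<mu> n b else 0) \<partial>\<mu>) \<partial>\<mu>)"
    by (intro nn_integral_cong nn_integral_add[symmetric]) measurable
  also have "\<dots> \<le> (\<integral>\<^sup>+a. (\<integral>\<^sup>+b. (if a < x then 1 else 0) * (if b < x then simplex_mass \<mu> n b else 0) \<partial>\<mu>) \<partial>\<mu>)"
    by (intro nn_integral_mono) auto
  also have "\<dots> = simplex_mass \<mu> 1 x * simplex_mass \<mu> (Suc n) x"
    by (simp add: nn_integral_cmult nn_integral_multc cong: if_cong)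
  finally show ?case .
qed

lemma simplex_mass_le:
  assumes "sigma_finite_measure \<mu>" and sb: "sets \<mu> = sets borel"
  shows "fact n * simplex_mass \<mu> n x \<le> emeasure \<mu> UNIV ^ n"
proof (induction n)
  case 0
  then show ?case by simp
next
  case (Suc n)
  have "simplex_mass \<mu> 1 x \<le> (\<integral>\<^sup>+a. 1 \<partial>\<mu>)"
    unfolding One_nat_def simplex_mass.simps by (intro nn_integral_mono) auto
  also have "\<dots> = emeasure \<mu> UNIV"
    using sets_eq_imp_space_eq[OF sb] by simp
  finally have one: "simplex_mass \<mu> 1 x \<le> emeasure \<mu> UNIV" .
  have "fact (Suc n) * simplex_mass \<mu> (Suc n) x = fact n * (of_nat (Suc n) * simplex_mass \<mu> (Suc n) x)"
    by (simp add: algebra_simps del: simplex_mass.simps)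
  also have "\<dots> \<le> fact n * (simplex_mass \<mu> 1 x * simplex_mass \<mu> n x)"
    by (intro mult_left_mono simplex_mass_shuffle assms) auto
  also have "\<dots> = simplex_mass \<mu> 1 x * (fact n * simplex_mass \<mu> n x)"
    by (simp add: algebra_simps del: simplex_mass.simps)
  also have "\<dots> \<le> emeasure \<mu> UNIV * emeasure \<mu> UNIV ^ n"
    by (intro mult_mono one Suc) auto
  finally show ?case by simp
qed

section \<open>Alternating Volterra operators\<close>

text \<open>The integration ranges, which alternate between closed and open at the upper end. Their
  alternation makes \<open>not_before_iff\<close> true: what fails to come before \<open>x\<close> in one range comes after \<open>x\<close>
  in the next one.\<close>

definition before :: "nat \<Rightarrow> real \<Rightarrow> real \<Rightarrow> bool" where
  "before n \<xi> x \<longleftrightarrow> (if even n then \<xi> \<le> x else \<xi> < x)"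

lemma measurable_before_compose [measurable (raw)]:
  assumes [measurable]: "f \<in> borel_measurable N" "g \<in> borel_measurable N"
  shows "Measurable.pred N (\<lambda>p. before n (f p) (g p))"
  by (cases "even n") (simp_all add: before_def)

lemma not_before_iff: "\<not> before n \<xi> x \<longleftrightarrow> before (Suc n) x \<xi>"
  by (auto simp: before_def)

lemma before_trans: "before (Suc n) \<eta> \<xi> \<Longrightarrow> before n \<xi> x \<Longrightarrow> before (Suc n) \<eta> x"
  by (auto simp: before_def split: if_splits)

definition bounded_borel :: "(real \<Rightarrow> real) \<Rightarrow> bool" where
  "bounded_borel \<phi> \<longleftrightarrow> \<phi> \<in> borel_measurable borel \<and> (\<exists>B. \<forall>x. \<bar>\<phi> x\<bar> \<le> B)"

lemma bounded_borel_const [simp]: "bounded_borel (\<lambda>_. c)"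
  by (auto simp: bounded_borel_def)

text \<open>Since \<open>j + p choose p\<close> is at most \<open>2 ^ (j + p)\<close>, one of the two factorials in the
  denominator absorbs \<open>fact (j + p)\<close>, and the other one still dominates \<open>(2 * a) ^ j\<close>.\<close>

lemma fact_shift_power_over_fact_squared_tendsto:
  fixes a :: real
  assumes "0 \<le> a"
  shows "(\<lambda>j. fact (j + p) * (a ^ j / (fact j)\<^sup>2)) \<longlonglongrightarrow> 0"
proof (rule Lim_null_comparison)
  have "summable (\<lambda>j. inverse (fact j) * (2 * a) ^ j)" by (rule summable_exp)
  from tendsto_mult_right_zero[OF summable_LIMSEQ_zero[OF this], of "fact p * 2 ^ p"]
  show "(\<lambda>j. fact p * 2 ^ p * (inverse (fact j) * (2 * a) ^ j)) \<longlonglongrightarrow> 0" .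
  have "norm (fact (j + p) * (a ^ j / (fact j)\<^sup>2)) \<le> fact p * 2 ^ p * (inverse (fact j) * (2 * a) ^ j)" for j
  proof -
    have "fact (j + p) = fact p * fact j * real (j + p choose p)"
      using binomial_fact_lemma[of p "j + p"] by (metis add_diff_cancel_right' le_add2 of_nat_fact of_nat_mult)
    also have "\<dots> \<le> fact p * fact j * 2 ^ (j + p)"
    proof (rule mult_left_mono)
      have "j + p choose p \<le> 2 ^ (j + p)" by (rule binomial_le_pow2)
      then show "real (j + p choose p) \<le> 2 ^ (j + p)" by (metis of_nat_le_iff of_nat_numeral of_nat_power)
    qed simp
    finally have "fact (j + p) * (a ^ j / (fact j)\<^sup>2) \<le> fact p * fact j * 2 ^ (j + p) * (a ^ j / (fact j)\<^sup>2)"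
      using assms by (intro mult_right_mono) auto
    also have "\<dots> = fact p * 2 ^ p * (inverse (fact j) * (2 * a) ^ j)"
      by (simp add: field_simps power2_eq_square power_add power_mult_distrib)
    finally show ?thesis using assms by simp
  qed
  then show "eventually (\<lambda>j. norm (fact (j + p) * (a ^ j / (fact j)\<^sup>2))
      \<le> fact p * 2 ^ p * (inverse (fact j) * (2 * a) ^ j)) sequentially"
    by (intro always_eventually allI)
qed

locale alternating_volterra =
  fixes M :: "nat \<Rightarrow> real measure"
  assumes finite_M: "finite_measure (M n)"
    and sets_M [measurable_cong]: "sets (M n) = sets borel"
    and M_periodic: "M (Suc (Suc n)) = M n"
begin

lemma space_M [simp]: "space (M n) = UNIV"
  using sets_eq_imp_space_eq[OF sets_M] by simp

lemma M_parity: "even m = even n \<Longrightarrow> M m = M n"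
proof -
  have "M k = M (k mod 2)" for k
  proof (induction k rule: induct_nat_012)
    case (ge2 k)
    then show ?case by (simp add: M_periodic)
  qed simp_all
  then show "even m = even n \<Longrightarrow> M m = M n" by (metis even_iff_mod_2_eq_zero not_mod_2_eq_1_eq_0)
qed

lemma integrable_M:
  assumes "bounded_borel \<phi>" "Measurable.pred borel P"
  shows "integrable (M n) (\<lambda>\<xi>. of_bool (P \<xi>) * \<phi> \<xi>)"
proof -
  interpret finite_measure "M n" by (rule finite_M)
  obtain B where B: "\<And>x. \<bar>\<phi> x\<bar> \<le> B" and [measurable]: "\<phi> \<in> borel_measurable borel"
    using assms(1) by (auto simp: bounded_borel_def)
  note [measurable] = assms(2)
  show ?thesis
    by (rule integrable_const_bound[where B = B])
       (use B order_trans[OF abs_ge_zero B] in \<open>auto simp: of_bool_def\<close>)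
qed

definition step :: "nat \<Rightarrow> (real \<Rightarrow> real) \<Rightarrow> real \<Rightarrow> real" where
  "step n \<phi> x = (\<integral>\<xi>. of_bool (before n \<xi> x) * \<phi> \<xi> \<partial>M n)"

text \<open>The composition \<open>step m \<circ> step (m + 1) \<circ> \<dots> \<circ> step (m + n - 1)\<close>, with the step of
  highest index applied first.\<close>

primrec iter :: "nat \<Rightarrow> nat \<Rightarrow> (real \<Rightarrow> real) \<Rightarrow> real \<Rightarrow> real" where
  "iter m 0 \<phi> = \<phi>"
| "iter m (Suc n) \<phi> = iter m n (step (m + n) \<phi>)"

text \<open>What remains of an iterated integral when its innermost variable \<open>\<eta>\<close> is held fixed: the
  variables between \<open>\<eta>\<close> and \<open>x\<close>, integrated from the outermost one inwards.\<close>

primrec kernel :: "nat \<Rightarrow> nat \<Rightarrow> real \<Rightarrow> real \<Rightarrow> real" where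
  "kernel m 0 x \<eta> = 1"
| "kernel m (Suc n) x \<eta> =
     (\<integral>\<xi>. of_bool (before (m + Suc n) \<eta> \<xi> \<and> before (m + n) \<xi> x) * kernel m n x \<xi> \<partial>M (m + n))"

lemma bounded_borel_integral:
  assumes "bounded_borel \<phi>" and [measurable]: "Measurable.pred (borel \<Otimes>\<^sub>M borel) (\<lambda>p. P (fst p) (snd p))"
  shows "bounded_borel (\<lambda>x. \<integral>\<xi>. of_bool (P x \<xi>) * \<phi> \<xi> \<partial>M n)"
proof -
  interpret finite_measure "M n" by (rule finite_M)
  obtain B where B: "\<And>x. \<bar>\<phi> x\<bar> \<le> B" and [measurable]: "\<phi> \<in> borel_measurable borel"
    using assms(1) by (auto simp: bounded_borel_def)
  have B0: "0 \<le> B" using order_trans[OF abs_ge_zero B] .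
  have "(\<lambda>x. \<integral>\<xi>. (if P x \<xi> then \<phi> \<xi> else 0) \<partial>M n) \<in> borel_measurable borel"
  proof (rule borel_measurable_lebesgue_integral)
    have "(\<lambda>p. if P (fst p) (snd p) then \<phi> (snd p) else 0) \<in> borel_measurable (borel \<Otimes>\<^sub>M M n)"
      by measurable
    then show "(\<lambda>(x, \<xi>). if P x \<xi> then \<phi> \<xi> else 0) \<in> borel_measurable (borel \<Otimes>\<^sub>M M n)"
      by (simp add: case_prod_beta')
  qed
  also have "(\<lambda>x. \<integral>\<xi>. (if P x \<xi> then \<phi> \<xi> else 0) \<partial>M n) = (\<lambda>x. \<integral>\<xi>. of_bool (P x \<xi>) * \<phi> \<xi> \<partial>M n)"
    by (intro ext Bochner_Integration.integral_cong) auto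
  finally have meas: "(\<lambda>x. \<integral>\<xi>. of_bool (P x \<xi>) * \<phi> \<xi> \<partial>M n) \<in> borel_measurable borel" .
  have "\<bar>\<integral>\<xi>. of_bool (P x \<xi>) * \<phi> \<xi> \<partial>M n\<bar> \<le> B * measure (M n) UNIV" for x
  proof -
    have [measurable]: "Measurable.pred borel (P x)"
      using measurable_compose[OF measurable_Pair1' assms(2), of x] by simp
    have "norm (\<integral>\<xi>. of_bool (P x \<xi>) * \<phi> \<xi> \<partial>M n) \<le> (\<integral>\<xi>. B \<partial>M n)"
      using B B0 by (intro Bochner_Integration.integral_norm_bound_integral integrable_M assms) auto
    then show ?thesis by (simp add: mult.commute)
  qed
  with meas show ?thesis unfolding bounded_borel_def by blast
qed

lemma bounded_borel_step: "bounded_borel \<phi> \<Longrightarrow> bounded_borel (step n \<phi>)"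
  unfolding step_def[abs_def] by (rule bounded_borel_integral) measurable

lemma bounded_borel_iter: "bounded_borel \<phi> \<Longrightarrow> bounded_borel (iter m n \<phi>)"
  by (induction n arbitrary: \<phi>) (auto intro: bounded_borel_step)

lemma bounded_borel_kernel: "bounded_borel (kernel m n x)"
proof (induction n)
  case 0
  have "kernel m 0 x = (\<lambda>_. 1)" by auto
  then show ?case by simp
next
  case (Suc n)
  then show ?case unfolding kernel.simps(2)[abs_def] by (rule bounded_borel_integral) measurable
qed

lemma step_affine:
  assumes "bounded_borel \<phi>" "bounded_borel \<psi>"
  shows "step n (\<lambda>x. c * \<phi> x + \<psi> x) x = c * step n \<phi> x + step n \<psi> x"
proof -
  have [measurable]: "Measurable.pred borel (\<lambda>\<xi>. before n \<xi> x)" by measurable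
  have "step n (\<lambda>x. c * \<phi> x + \<psi> x) x
      = (\<integral>\<xi>. c * (of_bool (before n \<xi> x) * \<phi> \<xi>) + of_bool (before n \<xi> x) * \<psi> \<xi> \<partial>M n)"
    unfolding step_def by (simp add: algebra_simps)
  also have "\<dots> = c * step n \<phi> x + step n \<psi> x"
    unfolding step_def
    by (subst Bochner_Integration.integral_add)
       (auto intro!: integrable_mult_right integrable_M assms)
  finally show ?thesis .
qed

lemma iter_affine:
  assumes "bounded_borel \<phi>" "bounded_borel \<psi>"
  shows "iter m n (\<lambda>x. c * \<phi> x + \<psi> x) x = c * iter m n \<phi> x + iter m n \<psi> x"
  using assms
proof (induction n arbitrary: \<phi> \<psi>)
  case (Suc n)
  have "step (m + n) (\<lambda>x. c * \<phi> x + \<psi> x) = (\<lambda>x. c * step (m + n) \<phi> x + step (m + n) \<psi> x)"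
    by (intro ext step_affine Suc.prems)
  then show ?case using Suc by (simp add: bounded_borel_step)
qed simp

lemma iter_outer: "iter m (Suc n) \<phi> = step m (iter (Suc m) n \<phi>)"
proof (induction n arbitrary: \<phi>)
  case (Suc n)
  show ?case by (subst iter.simps(2), subst Suc) simp
qed simp

text \<open>Each round replaces the last derivative, which is under \<open>N\<close> integrations, by its value at
  \<open>0\<close> plus one more integral.\<close>

lemma taylor:
  assumes "\<And>n. bounded_borel (d n)" and ftc: "\<And>n x. d n x = d n 0 + step n (d (Suc n)) x"
  shows "d m x = (\<Sum>k<N. d (m + k) 0 * iter m k (\<lambda>_. 1) x) + iter m N (d (m + N)) x"
proof (induction N)
  case (Suc N)
  have "d (m + N) = (\<lambda>x. d (m + N) 0 * 1 + step (m + N) (d (Suc (m + N))) x)"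
    unfolding mult_1_right by (rule ext) (rule ftc)
  then have "iter m N (d (m + N)) x = iter m N (\<lambda>x. d (m + N) 0 * 1 + step (m + N) (d (Suc (m + N))) x) x"
    by (rule arg_cong)
  also have "\<dots> = d (m + N) 0 * iter m N (\<lambda>_. 1) x + iter m (Suc N) (d (m + Suc N)) x"
    by (subst iter_affine) (auto intro: bounded_borel_step assms)
  finally show ?case using Suc by simp
qed simp

text \<open>By Fubini's theorem the innermost variable may be integrated last. This is possible one
  variable at a time since \<open>\<eta>\<close> before \<open>\<xi>\<close> before \<open>x\<close> implies that \<open>\<eta>\<close> lies in its own range below
  \<open>x\<close> (\<open>before_trans\<close>).\<close>

lemma iter_eq_kernel:
  assumes "bounded_borel \<phi>"
  shows "iter m (Suc n) \<phi> x = (\<integral>\<xi>. of_bool (before (m + n) \<xi> x) * (kernel m n x \<xi> * \<phi> \<xi>) \<partial>M (m + n))"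
  using assms
proof (induction n arbitrary: \<phi>)
  case 0
  then show ?case by (simp add: step_def)
next
  case (Suc n)
  let ?k = "m + n"
  interpret P: finite_measure "M ?k" by (rule finite_M)
  interpret Q: finite_measure "M (Suc ?k)" by (rule finite_M)
  interpret PQ: pair_sigma_finite "M ?k" "M (Suc ?k)" ..
  interpret PQ': finite_measure "M ?k \<Otimes>\<^sub>M M (Suc ?k)"
    by (rule finite_measure_pair_measure[OF finite_M finite_M])
  obtain A B where A: "\<And>\<xi>. \<bar>kernel m n x \<xi>\<bar> \<le> A" and B: "\<And>x. \<bar>\<phi> x\<bar> \<le> B"
    and [measurable]: "\<phi> \<in> borel_measurable borel" "kernel m n x \<in> borel_measurable borel"
    using Suc.prems bounded_borel_kernel[of m n x] by (auto simp: bounded_borel_def)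
  have A0: "0 \<le> A" and B0: "0 \<le> B"
    using order_trans[OF abs_ge_zero A] order_trans[OF abs_ge_zero B] by auto
  let ?h = "\<lambda>\<xi> \<eta>. if before (Suc ?k) \<eta> \<xi> \<and> before ?k \<xi> x then kernel m n x \<xi> * \<phi> \<eta> else 0"
  have int: "integrable (M ?k \<Otimes>\<^sub>M M (Suc ?k)) (\<lambda>(\<xi>, \<eta>). ?h \<xi> \<eta>)"
  proof (rule PQ'.integrable_const_bound[where B = "A * B"])
    have "\<bar>?h \<xi> \<eta>\<bar> \<le> A * B" for \<xi> \<eta>
      using A0 B0 by (auto simp: abs_mult intro!: mult_mono A B)
    then show "AE p in M ?k \<Otimes>\<^sub>M M (Suc ?k). norm (case p of (\<xi>, \<eta>) \<Rightarrow> ?h \<xi> \<eta>) \<le> A * B"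
      by (auto split: prod.split)
    have "(\<lambda>p. ?h (fst p) (snd p)) \<in> borel_measurable (M ?k \<Otimes>\<^sub>M M (Suc ?k))"
      by measurable
    then show "(\<lambda>(\<xi>, \<eta>). ?h \<xi> \<eta>) \<in> borel_measurable (M ?k \<Otimes>\<^sub>M M (Suc ?k))"
      by (simp add: case_prod_beta')
  qed
  have "iter m (Suc (Suc n)) \<phi> x = iter m (Suc n) (step (Suc ?k) \<phi>) x" by simp
  also have "\<dots> = (\<integral>\<xi>. of_bool (before ?k \<xi> x) * (kernel m n x \<xi> * step (Suc ?k) \<phi> \<xi>) \<partial>M ?k)"
    by (rule Suc.IH) (rule bounded_borel_step[OF Suc.prems])
  also have "\<dots> = (\<integral>\<xi>. (\<integral>\<eta>. ?h \<xi> \<eta> \<partial>M (Suc ?k)) \<partial>M ?k)"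
    unfolding step_def mult.assoc[symmetric] integral_mult_right_zero[symmetric]
    by (intro Bochner_Integration.integral_cong) auto
  also have "\<dots> = (\<integral>\<eta>. (\<integral>\<xi>. ?h \<xi> \<eta> \<partial>M ?k) \<partial>M (Suc ?k))"
    by (rule PQ.Fubini_integral[OF int, symmetric])
  also have "\<dots> = (\<integral>\<eta>. of_bool (before (Suc ?k) \<eta> x) * (kernel m (Suc n) x \<eta> * \<phi> \<eta>) \<partial>M (Suc ?k))"
    unfolding kernel.simps mult.assoc[symmetric] integral_mult_right_zero[symmetric] integral_mult_left_zero[symmetric]
    by (intro Bochner_Integration.integral_cong) (auto dest: before_trans)
  finally show ?case by simp
qed

text \<open>The recursion of \<open>F\<close> and \<open>G\<close>: the range of \<open>\<xi>\<close> below \<open>x\<close> that lies beyond \<open>s\<close> is the range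
  below \<open>x\<close> minus the range below \<open>s\<close>.\<close>

lemma kernel_Suc_eq_diff:
  assumes "s \<le> x"
  shows "kernel m (Suc n) x s
    = (\<integral>\<xi>. of_bool (before (m + n) \<xi> x) * kernel m n x \<xi> \<partial>M (m + n))
    - (\<integral>\<xi>. of_bool (before (m + n) \<xi> s) * kernel m n x \<xi> \<partial>M (m + n))"
proof -
  have "before (m + n) \<xi> s \<Longrightarrow> before (m + n) \<xi> x" for \<xi>
    using assms by (auto simp: before_def split: if_splits)
  then have "kernel m (Suc n) x s
    = (\<integral>\<xi>. of_bool (before (m + n) \<xi> x) * kernel m n x \<xi> - of_bool (before (m + n) \<xi> s) * kernel m n x \<xi> \<partial>M (m + n))"
    unfolding kernel.simps
    by (intro Bochner_Integration.integral_cong) (auto simp: not_before_iff[symmetric])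
  also have "\<dots> = (\<integral>\<xi>. of_bool (before (m + n) \<xi> x) * kernel m n x \<xi> \<partial>M (m + n))
    - (\<integral>\<xi>. of_bool (before (m + n) \<xi> s) * kernel m n x \<xi> \<partial>M (m + n))"
    by (intro Bochner_Integration.integral_diff integrable_M bounded_borel_kernel) measurable
  finally show ?thesis .
qed

lemma taylor_partial_sum:
  assumes "\<And>n. bounded_borel (d n)" "\<And>n x. d n x = d n 0 + step n (d (Suc n)) x"
  shows "(\<Sum>k<N. d (Suc k + m) 0 * iter m (Suc k) (\<lambda>_. 1) x)
    = d m x - d m 0 - iter m (Suc N) (d (m + Suc N)) x"
  using taylor[of d m x "Suc N", OF assms]
  by (simp add: sum.lessThan_Suc_shift add_ac del: iter.simps(2) sum.lessThan_Suc)

lemma abs_step_le: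
  assumes "bounded_borel \<phi>"
  shows "ennreal \<bar>step n \<phi> x\<bar> \<le> (\<integral>\<^sup>+\<xi>. (if before n \<xi> x then ennreal \<bar>\<phi> \<xi>\<bar> else 0) \<partial>M n)"
proof -
  have "ennreal (norm (step n \<phi> x)) \<le> (\<integral>\<^sup>+\<xi>. ennreal (norm (of_bool (before n \<xi> x) * \<phi> \<xi>)) \<partial>M n)"
    unfolding step_def by (intro integral_norm_bound_ennreal integrable_M assms) measurable
  also have "\<dots> = (\<integral>\<^sup>+\<xi>. (if before n \<xi> x then ennreal \<bar>\<phi> \<xi>\<bar> else 0) \<partial>M n)"
    by (intro nn_integral_cong) auto
  finally show ?thesis by simp
qed

lemma iter_parity: "even m = even m' \<Longrightarrow> iter m n \<phi> = iter m' n \<phi>"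
proof (induction n arbitrary: \<phi>)
  case (Suc n)
  have "even (m + n) = even (m' + n)" using Suc.prems by auto
  then have "step (m + n) \<phi> = step (m' + n) \<phi>"
    unfolding step_def[abs_def] before_def[abs_def] using M_parity[of "m + n" "m' + n"] by presburger
  then show ?case using Suc by simp
qed simp

text \<open>The asymmetry between \<open>x\<close> and \<open>y\<close> records that the outermost variable of the first measure
  may equal \<open>x\<close> whereas that of the second is strictly smaller. In the induction step the inner
  variable \<open>\<eta>\<close> is strictly below \<open>\<xi>\<close>, so the hypothesis applies with \<open>\<xi>\<close> in the place of \<open>y\<close>; the first
  simplex then no longer depends on \<open>\<eta>\<close> and can be taken out of the inner integral.\<close>

lemma abs_iter_le_simplex_mass:
  assumes "bounded_borel \<phi>" "\<And>x. \<bar>\<phi> x\<bar> \<le> B" "x < y"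
  shows "ennreal \<bar>iter 0 (2 * n) \<phi> x\<bar> \<le> ennreal B * (simplex_mass (M 0) n y * simplex_mass (M 1) n x)"
  using assms(3)
proof (induction n arbitrary: x y)
  case 0
  then show ?case using assms(2) by (simp add: ennreal_leI)
next
  case (Suc n)
  interpret P: finite_measure "M 0" by (rule finite_M)
  interpret Q: finite_measure "M 1" by (rule finite_M)
  have [measurable]: "simplex_mass (M 0) n \<in> borel_measurable borel" "simplex_mass (M 1) n \<in> borel_measurable borel"
    by (intro measurable_simplex_mass sets_M P.sigma_finite_measure_axioms Q.sigma_finite_measure_axioms)+
  let ?p = "iter 0 (2 * n) \<phi>"
  have bp: "bounded_borel ?p" by (rule bounded_borel_iter[OF assms(1)])
  have eq: "iter 0 (2 * Suc n) \<phi> = step 0 (step 1 ?p)"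
    using iter_outer[of 0 "Suc (2 * n)" \<phi>] iter_outer[of 1 "2 * n" \<phi>] iter_parity[of 2 0 "2 * n" \<phi>]
    by (simp add: numeral_2_eq_2 del: iter.simps)
  have inner: "ennreal \<bar>step 1 ?p \<xi>\<bar> \<le> ennreal B * simplex_mass (M 0) n \<xi> * simplex_mass (M 1) (Suc n) \<xi>" for \<xi>
  proof -
    have "ennreal \<bar>step 1 ?p \<xi>\<bar> \<le> (\<integral>\<^sup>+\<eta>. (if \<eta> < \<xi> then ennreal \<bar>?p \<eta>\<bar> else 0) \<partial>M 1)"
      using abs_step_le[OF bp, of 1 \<xi>] by (simp add: before_def)
    also have "\<dots> \<le> (\<integral>\<^sup>+\<eta>. ennreal B * simplex_mass (M 0) n \<xi> * (if \<eta> < \<xi> then simplex_mass (M 1) n \<eta> else 0) \<partial>M 1)"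
      using Suc.IH by (intro nn_integral_mono) (auto simp: mult.assoc)
    also have "\<dots> = ennreal B * simplex_mass (M 0) n \<xi> * simplex_mass (M 1) (Suc n) \<xi>"
      unfolding simplex_mass.simps by (rule nn_integral_cmult) measurable
    finally show ?thesis .
  qed
  have "ennreal \<bar>iter 0 (2 * Suc n) \<phi> x\<bar>
      \<le> (\<integral>\<^sup>+\<xi>. (if \<xi> \<le> x then ennreal \<bar>step 1 ?p \<xi>\<bar> else 0) \<partial>M 0)"
    unfolding eq using abs_step_le[OF bounded_borel_step[OF bp], of 0 1 x] by (simp add: before_def)
  also have "\<dots> \<le> (\<integral>\<^sup>+\<xi>. ennreal B * simplex_mass (M 1) (Suc n) x * (if \<xi> < y then simplex_mass (M 0) n \<xi> else 0) \<partial>M 0)"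
  proof (intro nn_integral_mono)
    fix \<xi>
    show "(if \<xi> \<le> x then ennreal \<bar>step 1 ?p \<xi>\<bar> else 0)
        \<le> ennreal B * simplex_mass (M 1) (Suc n) x * (if \<xi> < y then simplex_mass (M 0) n \<xi> else 0)"
    proof (cases "\<xi> \<le> x")
      case True
      have "ennreal \<bar>step 1 ?p \<xi>\<bar> \<le> ennreal B * simplex_mass (M 0) n \<xi> * simplex_mass (M 1) (Suc n) \<xi>" by (rule inner)
      also have "\<dots> \<le> ennreal B * simplex_mass (M 0) n \<xi> * simplex_mass (M 1) (Suc n) x"
        by (intro mult_left_mono simplex_mass_mono True) auto
      finally show ?thesis using True Suc.prems by (simp add: mult_ac del: simplex_mass.simps)
    qed simp
  qed
  also have "\<dots> = ennreal B * simplex_mass (M 1) (Suc n) x * simplex_mass (M 0) (Suc n) y"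
    unfolding simplex_mass.simps(2)[of "M 0"] by (rule nn_integral_cmult) measurable
  finally show ?case by (simp add: mult_ac del: simplex_mass.simps iter.simps)
qed

definition mass :: "nat \<Rightarrow> real" where "mass n = measure (M n) UNIV"

lemma abs_iter_even_le:
  assumes "bounded_borel \<phi>" "\<And>x. \<bar>\<phi> x\<bar> \<le> B"
  shows "\<bar>iter 0 (2 * n) \<phi> x\<bar> \<le> B * ((mass 0 * mass 1) ^ n / (fact n)\<^sup>2)"
proof -
  have simplex_real: "simplex_mass (M k) n y \<le> ennreal (mass k ^ n / fact n)" for k y
  proof -
    interpret finite_measure "M k" by (rule finite_M)
    have "fact n * simplex_mass (M k) n y \<le> emeasure (M k) UNIV ^ n"
      by (rule simplex_mass_le[OF sigma_finite_measure_axioms sets_M])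
    also have "\<dots> = ennreal (mass k ^ n)"
      by (simp add: mass_def emeasure_eq_measure ennreal_power)
    also have "\<dots> = fact n * ennreal (mass k ^ n / fact n)"
      by (subst ennreal_fact[symmetric], subst ennreal_mult[symmetric]) (auto simp: mass_def)
    finally show ?thesis
      by (subst (asm) ennreal_mult_le_mult_iff) auto
  qed
  have B0: "0 \<le> B" using order_trans[OF abs_ge_zero assms(2)] .
  have "ennreal \<bar>iter 0 (2 * n) \<phi> x\<bar> \<le> ennreal B * (simplex_mass (M 0) n (x + 1) * simplex_mass (M 1) n x)"
    by (rule abs_iter_le_simplex_mass[OF assms]) simp
  also have "\<dots> \<le> ennreal B * (ennreal (mass 0 ^ n / fact n) * ennreal (mass 1 ^ n / fact n))"
    by (intro mult_left_mono mult_mono simplex_real) auto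
  also have "\<dots> = ennreal (B * ((mass 0 * mass 1) ^ n / (fact n)\<^sup>2))"
    using B0 by (simp add: ennreal_mult[symmetric] mass_def power_mult_distrib power2_eq_square)
  finally show ?thesis
    using B0 by (subst (asm) ennreal_le_iff) (auto simp: mass_def)
qed

lemma abs_step_le_mass:
  assumes "bounded_borel \<phi>" "\<And>x. \<bar>\<phi> x\<bar> \<le> B"
  shows "\<bar>step n \<phi> x\<bar> \<le> mass n * B"
proof -
  interpret finite_measure "M n" by (rule finite_M)
  have "0 \<le> B" using order_trans[OF abs_ge_zero assms(2)] .
  then have "norm (step n \<phi> x) \<le> (\<integral>\<xi>. B \<partial>M n)"
    unfolding step_def
    by (intro Bochner_Integration.integral_norm_bound_integral integrable_M assms) (use assms(2) in auto)
  then show ?thesis by (simp add: mass_def)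
qed

lemma mass_nonneg: "0 \<le> mass n" by (simp add: mass_def)

lemma mass_le: "mass n \<le> mass 0 + mass 1"
proof (cases "even n")
  case True
  then have "M n = M 0" by (intro M_parity) simp
  then show ?thesis using mass_nonneg[of 1] by (simp add: mass_def)
next
  case False
  then have "M n = M 1" by (intro M_parity) simp
  then show ?thesis using mass_nonneg[of 0] by (simp add: mass_def)
qed

lemma abs_iter_le:
  assumes "bounded_borel \<phi>" "\<And>x. \<bar>\<phi> x\<bar> \<le> B"
  shows "\<bar>iter 0 N \<phi> x\<bar> \<le> (1 + (mass 0 + mass 1)) * B * ((mass 0 * mass 1) ^ (N div 2) / (fact (N div 2))\<^sup>2)"
proof -
  let ?j = "N div 2" and ?Q = "(mass 0 * mass 1) ^ (N div 2) / (fact (N div 2))\<^sup>2 :: real"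
  have B0: "0 \<le> B" using order_trans[OF abs_ge_zero assms(2)] .
  have Q0: "0 \<le> ?Q" using mass_nonneg by simp
  show ?thesis
  proof (cases "even N")
    case True
    then have "N = 2 * ?j" by simp
    then have "\<bar>iter 0 N \<phi> x\<bar> \<le> B * ?Q"
      using abs_iter_even_le[OF assms, of ?j x] by simp
    also have "\<dots> \<le> (1 + (mass 0 + mass 1)) * B * ?Q"
      using mass_nonneg B0 Q0 by (intro mult_right_mono) (auto simp: algebra_simps)
    finally show ?thesis .
  next
    case False
    then have "N = Suc (2 * ?j)" by presburger
    then have "\<bar>iter 0 N \<phi> x\<bar> = \<bar>iter 0 (2 * ?j) (step (2 * ?j) \<phi>) x\<bar>"
      by (metis add_0 iter.simps(2))
    also have "\<dots> \<le> mass (2 * ?j) * B * ?Q"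
      by (intro abs_iter_even_le bounded_borel_step abs_step_le_mass assms)
    also have "\<dots> \<le> (1 + (mass 0 + mass 1)) * B * ?Q"
      using mass_le[of "2 * ?j"] B0 Q0 by (intro mult_right_mono) auto
    finally show ?thesis .
  qed
qed

text \<open>The sharp estimate is available for an even number of integrations beginning with even
  index. Any other number, or an odd starting index, costs at most two steps estimated by the total
  mass.\<close>

lemma abs_iter_Suc_le:
  assumes "bounded_borel \<phi>" "\<And>x. \<bar>\<phi> x\<bar> \<le> B"
  defines "s \<equiv> mass 0 + mass 1"
  shows "\<bar>iter m (Suc N) \<phi> x\<bar> \<le> s * (1 + s) * B * ((mass 0 * mass 1) ^ (N div 2) / (fact (N div 2))\<^sup>2)"
proof -
  let ?Q = "(mass 0 * mass 1) ^ (N div 2) / (fact (N div 2))\<^sup>2 :: real"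
  have B0: "0 \<le> B" using order_trans[OF abs_ge_zero assms(2)] .
  have Q0: "0 \<le> ?Q" using mass_nonneg by simp
  have s0: "0 \<le> s" using mass_nonneg by (simp add: s_def)
  show ?thesis
  proof (cases "even m")
    case True
    have "\<bar>iter m (Suc N) \<phi> x\<bar> = \<bar>iter 0 N (step (m + N) \<phi>) x\<bar>"
      using iter_parity[of m 0 N] True by simp
    also have "\<dots> \<le> (1 + s) * (s * B) * ?Q"
      unfolding s_def
    proof (intro abs_iter_le bounded_borel_step assms)
      fix y
      show "\<bar>step (m + N) \<phi> y\<bar> \<le> (mass 0 + mass 1) * B"
        using abs_step_le_mass[OF assms(1,2), of "m + N" y] mult_right_mono[OF mass_le B0, of "m + N"]
        by linarith
    qed
    finally show ?thesis by (simp add: mult_ac)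
  next
    case False
    have "\<bar>iter m (Suc N) \<phi> x\<bar> = \<bar>step m (iter 0 N \<phi>) x\<bar>"
      using iter_parity[of "Suc m" 0 N] False by (simp add: iter_outer del: iter.simps)
    also have "\<dots> \<le> mass m * ((1 + s) * B * ?Q)"
      unfolding s_def by (intro abs_step_le_mass bounded_borel_iter assms abs_iter_le)
    also have "\<dots> \<le> s * ((1 + s) * B * ?Q)"
      using mass_le[of m] B0 Q0 s0
      by (intro mult_right_mono mult_nonneg_nonneg) (simp_all add: s_def)
    finally show ?thesis by (simp add: mult_ac)
  qed
qed

text \<open>The bound \<open>c (n div 2)\<close> with \<open>n = m + Suc N\<close> is eventually at most \<open>fact (N div 2 + m + 1)\<close>, while
  the \<open>Suc N\<close> integrations contribute \<open>(fact (N div 2))\<^sup>2\<close> in the denominator.\<close>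

lemma iter_remainder_tendsto_0:
  assumes d: "\<And>n. bounded_borel (d n)" and dc: "\<And>n x. \<bar>d n x\<bar> \<le> c (n div 2)"
    and c: "eventually (\<lambda>n. c n \<le> fact n) sequentially"
  shows "\<exists>r. r \<longlonglongrightarrow> 0 \<and> (\<forall>\<^sub>F N in sequentially. \<forall>x. \<bar>iter m (Suc N) (d (m + Suc N)) x\<bar> \<le> r N)"
proof -
  define K where "K = (mass 0 + mass 1) * (1 + (mass 0 + mass 1))"
  have K0: "0 \<le> K" using mass_nonneg by (simp add: K_def)
  let ?a = "mass 0 * mass 1"
  define q where "q j = fact (j + (m + 1)) * (?a ^ j / (fact j)\<^sup>2)" for j
  have "q \<longlonglongrightarrow> 0"
    unfolding q_def by (rule fact_shift_power_over_fact_squared_tendsto) (simp add: mass_nonneg)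
  moreover have "filterlim (\<lambda>N::nat. N div 2) sequentially sequentially"
    unfolding filterlim_at_top
  proof
    show "\<forall>\<^sub>F N in sequentially. Z \<le> N div 2" for Z :: nat
      by (rule eventually_sequentiallyI[of "2 * Z"]) linarith
  qed
  ultimately have "(\<lambda>N. q (N div 2)) \<longlonglongrightarrow> 0" by (rule filterlim_compose)
  then have lim: "(\<lambda>N. K * q (N div 2)) \<longlonglongrightarrow> 0" by (rule tendsto_mult_right_zero)
  obtain i where i: "\<And>n. n \<ge> i \<Longrightarrow> c n \<le> fact n"
    using c by (auto simp: eventually_sequentially)
  have "\<bar>iter m (Suc N) (d (m + Suc N)) x\<bar> \<le> K * q (N div 2)" if "N \<ge> 2 * i" for N x
  proof -
    let ?n = "m + Suc N" and ?Q = "?a ^ (N div 2) / (fact (N div 2))\<^sup>2 :: real"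
    have "c (?n div 2) \<le> fact (?n div 2)" using that by (intro i) linarith
    also have "\<dots> \<le> fact (N div 2 + (m + 1))" by (intro fact_mono) linarith
    finally have cle: "c (?n div 2) \<le> fact (N div 2 + (m + 1))" .
    have "\<bar>iter m (Suc N) (d ?n) x\<bar> \<le> K * c (?n div 2) * ?Q"
      unfolding K_def by (rule abs_iter_Suc_le[OF d dc])
    also have "\<dots> \<le> K * fact (N div 2 + (m + 1)) * ?Q"
      using cle K0 mass_nonneg by (intro mult_right_mono mult_left_mono) auto
    finally show ?thesis by (simp add: q_def mult_ac)
  qed
  then show ?thesis
    using lim by (intro exI[of _ "\<lambda>N. K * q (N div 2)"]) (auto intro: eventually_sequentiallyI[of "2 * i"])
qed

end

section \<open>Sampling and extending one-sided continuous functions\<close>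

text \<open>The points \<open>s n x\<close> of the grid of mesh \<open>1 / (n + 1)\<close> lie strictly to the right of \<open>x\<close> and
  converge to it, so \<open>f\<close> is a pointwise limit of step functions.\<close>

lemma borel_measurable_right_continuous:
  fixes f :: "real \<Rightarrow> real"
  assumes "\<And>x. continuous (at_right x) f"
  shows "f \<in> borel_measurable borel"
proof (rule borel_measurable_LIMSEQ_real)
  define s where "s n x = (real_of_int \<lfloor>real (Suc n) * x\<rfloor> + 1) / real (Suc n)" for n x
  show "(\<lambda>x. f (s n x)) \<in> borel_measurable borel" for n
  proof -
    have "(\<lambda>k::int. f ((real_of_int k + 1) / real (Suc n))) \<in> borel_measurable (count_space UNIV)"
      by simp
    then show ?thesis unfolding s_def by measurable
  qed
  show "(\<lambda>n. f (s n x)) \<longlonglongrightarrow> f x" if "x \<in> space borel" for x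
  proof -
    have gt: "x < s n x" for n
      unfolding s_def by (simp add: pos_less_divide_eq mult.commute)
    have le: "s n x \<le> x + inverse (real (Suc n))" for n
    proof -
      have "real_of_int \<lfloor>real (Suc n) * x\<rfloor> + 1 \<le> real (Suc n) * x + 1" by linarith
      then have "s n x \<le> (real (Suc n) * x + 1) / real (Suc n)"
        unfolding s_def by (intro divide_right_mono) auto
      also have "\<dots> = x + inverse (real (Suc n))" by (simp add: field_simps)
      finally show ?thesis .
    qed
    have "(\<lambda>n. s n x) \<longlonglongrightarrow> x"
    proof (rule tendsto_sandwich[where f = "\<lambda>_. x"])
      show "(\<lambda>n. x + inverse (real (Suc n))) \<longlonglongrightarrow> x"
        using tendsto_add[OF tendsto_const LIMSEQ_inverse_real_of_nat, of x] by simp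
    qed (use gt le in \<open>auto intro!: always_eventually less_imp_le\<close>)
    then have "filterlim (\<lambda>n. s n x) (at_right x) sequentially"
      using gt by (intro tendsto_imp_filterlim_at_right) auto
    moreover have "(f \<longlongrightarrow> f x) (at_right x)"
      using assms[of x] by (simp add: continuous_within)
    ultimately show ?thesis by (rule filterlim_compose[rotated])
  qed
qed

lemma borel_measurable_left_continuous:
  fixes f :: "real \<Rightarrow> real"
  assumes "\<And>x. continuous (at_left x) f"
  shows "f \<in> borel_measurable borel"
proof -
  have [measurable]: "(\<lambda>y. f (- y)) \<in> borel_measurable borel"
    by (rule borel_measurable_right_continuous) (simp add: continuous_at_right_reflect assms)
  have "(\<lambda>y. f (- (- y))) \<in> borel_measurable borel"
    by (rule measurable_compose[of uminus borel borel "\<lambda>y. f (- y)"]) measurable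
  then show ?thesis by simp
qed

text \<open>Composition with \<open>clamp01\<close> extends a function on the unit interval by constants. It
  keeps one-sided continuity and bounds, and so yields functions that are Borel and bounded on the
  whole line.\<close>

definition clamp01 :: "real \<Rightarrow> real" where "clamp01 x = max 0 (min 1 x)"

lemma clamp01_mem [simp]: "clamp01 x \<in> {0..1}" "0 \<le> clamp01 x" "clamp01 x \<le> 1"
  by (auto simp: clamp01_def)

lemma clamp01_id [simp]: "0 \<le> x \<Longrightarrow> x \<le> 1 \<Longrightarrow> clamp01 x = x"
  by (simp add: clamp01_def)

lemma continuous_at_right_clamp01:
  assumes "\<And>x. 0 \<le> x \<Longrightarrow> x < 1 \<Longrightarrow> continuous (at_right x) g"
  shows "continuous (at_right x) (\<lambda>y. g (clamp01 y))"
proof -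
  consider "x < 0" | "0 \<le> x" "x < 1" | "1 \<le> x" by linarith
  then show ?thesis
  proof cases
    case 1
    then have "eventually (\<lambda>y. g (clamp01 y) = g (clamp01 x)) (at_right x)"
      unfolding eventually_at_right_field by (intro exI[of _ 0]) (auto simp: clamp01_def)
    then show ?thesis unfolding continuous_within by (rule tendsto_eventually)
  next
    case 2
    then have "eventually (\<lambda>y. g (clamp01 y) = g y) (at_right x)"
      unfolding eventually_at_right_field by (intro exI[of _ 1]) (auto simp: clamp01_def)
    then show ?thesis using assms[OF 2] 2
      unfolding continuous_within by (subst tendsto_cong) auto
  next
    case 3
    then have "eventually (\<lambda>y. g (clamp01 y) = g (clamp01 x)) (at_right x)"
      unfolding eventually_at_right_field by (intro exI[of _ "x + 1"]) (auto simp: clamp01_def)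
    then show ?thesis unfolding continuous_within by (rule tendsto_eventually)
  qed
qed

lemma continuous_at_left_clamp01:
  assumes "\<And>x. 0 < x \<Longrightarrow> x \<le> 1 \<Longrightarrow> continuous (at_left x) g"
  shows "continuous (at_left x) (\<lambda>y. g (clamp01 y))"
proof -
  consider "1 < x" | "0 < x" "x \<le> 1" | "x \<le> 0" by linarith
  then show ?thesis
  proof cases
    case 1
    then have "eventually (\<lambda>y. g (clamp01 y) = g (clamp01 x)) (at_left x)"
      unfolding eventually_at_left_field by (intro exI[of _ 1]) (auto simp: clamp01_def)
    then show ?thesis unfolding continuous_within by (rule tendsto_eventually)
  next
    case 2
    then have "eventually (\<lambda>y. g (clamp01 y) = g y) (at_left x)"
      unfolding eventually_at_left_field by (intro exI[of _ 0]) (auto simp: clamp01_def)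
    then show ?thesis using assms[OF 2] 2
      unfolding continuous_within by (subst tendsto_cong) auto
  next
    case 3
    then have "eventually (\<lambda>y. g (clamp01 y) = g (clamp01 x)) (at_left x)"
      unfolding eventually_at_left_field by (intro exI[of _ "x - 1"]) (auto simp: clamp01_def)
    then show ?thesis unfolding continuous_within by (rule tendsto_eventually)
  qed
qed

section \<open>The Volterra operators of a pair of Stieltjes functions\<close>

locale stieltjes_pair =
  fixes W V :: "real \<Rightarrow> real"
  assumes W_mono: "strict_mono W" and V_mono: "strict_mono V"
    and W_cadlag: "cadlag_on UNIV W" and V_caglad: "caglad_on UNIV V"
    and W_0: "W 0 = 0" and V_0: "V 0 = 0"
begin

text \<open>Restricting the two Stieltjes measures to the unit interval makes them finite. Which endpoint
  is kept matters: for \<open>x\<close> in that interval the range \<open>{..x}\<close> becomes \<open>{0<..x}\<close> for \<open>dW\<close>, and \<open>{..<x}\<close> becomes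
  \<open>{0..<x}\<close> for \<open>dV\<close>.\<close>

definition \<mu> :: "nat \<Rightarrow> real measure" where
  "\<mu> n = (if even n then density (dW W) (\<lambda>x. ennreal (indicator {0<..1} x))
         else density (dV V) (\<lambda>x. ennreal (indicator {0..<1} x)))"

lemma sets_dW [measurable_cong, simp]: "sets (dW W) = sets borel"
  by (simp add: dW_def)

lemma sets_dV [measurable_cong, simp]: "sets (dV V) = sets borel"
  by (simp add: dV_def)

lemma space_dW [simp]: "space (dW W) = UNIV" by (simp add: dW_def)
lemma space_dV [simp]: "space (dV V) = UNIV" by (simp add: dV_def)

sublocale alternating_volterra \<mu>
proof (rule alternating_volterra.intro)
  show "sets (\<mu> n) = sets borel" for n by (simp add: \<mu>_def)
  show "\<mu> (Suc (Suc n)) = \<mu> n" for n by (simp add: \<mu>_def)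
  show "finite_measure (\<mu> n)" for n
    using emeasure_dW_Ioc[OF W_mono W_cadlag, of 0 1] emeasure_dV_Ico[OF V_mono V_caglad, of 0 1]
    by (intro finite_measureI) (simp add: \<mu>_def emeasure_density ennreal_indicator)
qed

lemma integral_before:
  fixes \<phi> :: "real \<Rightarrow> real"
  assumes [measurable]: "\<phi> \<in> borel_measurable borel"
  shows "(\<integral>\<xi>. of_bool (before n \<xi> x) * \<phi> \<xi> \<partial>\<mu> n)
    = (if even n then LINT \<xi>:{0<..clamp01 x}|dW W. \<phi> \<xi> else LINT \<xi>:{0..<clamp01 x}|dV V. \<phi> \<xi>)"
proof -
  have meas: "(\<lambda>\<xi>. of_bool (before n \<xi> x) * \<phi> \<xi>) \<in> borel_measurable borel"
    unfolding of_bool_def by measurable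
  show ?thesis
  proof (cases "even n")
    case True
    have "(\<integral>\<xi>. of_bool (before n \<xi> x) * \<phi> \<xi> \<partial>\<mu> n)
        = (\<integral>\<xi>. indicator {0<..1} \<xi> *\<^sub>R (of_bool (before n \<xi> x) * \<phi> \<xi>) \<partial>dW W)"
    proof -
      have "\<mu> n = density (dW W) (\<lambda>x. ennreal (indicator {0<..1} x))"
        using True by (simp add: \<mu>_def)
      then show ?thesis using meas by (simp only:) (rule integral_density; simp)
    qed
    also have "\<dots> = (LINT \<xi>:{0<..clamp01 x}|dW W. \<phi> \<xi>)"
      unfolding set_lebesgue_integral_def using True
      by (intro Bochner_Integration.integral_cong) (auto simp: before_def clamp01_def indicator_def)
    finally show ?thesis using True by simp
  next
    case False
    have "(\<integral>\<xi>. of_bool (before n \<xi> x) * \<phi> \<xi> \<partial>\<mu> n)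
        = (\<integral>\<xi>. indicator {0..<1} \<xi> *\<^sub>R (of_bool (before n \<xi> x) * \<phi> \<xi>) \<partial>dV V)"
    proof -
      have "\<mu> n = density (dV V) (\<lambda>x. ennreal (indicator {0..<1} x))"
        using False by (simp add: \<mu>_def)
      then show ?thesis using meas by (simp only:) (rule integral_density; simp)
    qed
    also have "\<dots> = (LINT \<xi>:{0..<clamp01 x}|dV V. \<phi> \<xi>)"
      unfolding set_lebesgue_integral_def using False
      by (intro Bochner_Integration.integral_cong) (auto simp: before_def clamp01_def indicator_def)
    finally show ?thesis using False by simp
  qed
qed

lemma step_eq:
  assumes "\<phi> \<in> borel_measurable borel"
  shows "step n \<phi> x
    = (if even n then LINT \<xi>:{0<..clamp01 x}|dW W. \<phi> \<xi> else LINT \<xi>:{0..<clamp01 x}|dV V. \<phi> \<xi>)"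
  unfolding step_def by (rule integral_before[OF assms])

lemma measurable_kernel: "kernel m n x \<in> borel_measurable borel"
  using bounded_borel_kernel[of m n x] by (simp add: bounded_borel_def)

lemma kernel_0: "kernel m 0 x = (\<lambda>_. 1)"
  by (rule ext) simp

text \<open>The integrand in the recursion for \<open>F\<close> is the kernel, by \<open>kernel_Suc_eq_diff\<close>; hence \<open>F\<close>
  at \<open>s\<close> integrates the preceding kernel over the range below \<open>s\<close>. For \<open>G\<close> the same holds with all
  indices shifted by one, because the outermost integration is against \<open>dV\<close>.\<close>

lemma F_eq_integral_kernel:
  assumes "x \<le> 1" "0 \<le> s" "s \<le> x"
  shows "F W V (Suc n) x s = (\<integral>\<xi>. of_bool (before n \<xi> s) * kernel 0 n x \<xi> \<partial>\<mu> n)"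
  using assms(2,3)
proof (induction n arbitrary: s)
  case 0
  have "(LINT \<xi>:{0<..s}|dW W. (1::real)) = W s"
    using emeasure_dW_Ioc[OF W_mono W_cadlag, of 0 s] W_mono 0 W_0
    by (simp add: set_lebesgue_integral_def measure_def strict_mono_less_eq[of W 0 s, simplified W_0])
  then show ?case
    using integral_before[OF measurable_kernel, of 0 s 0 0 x] 0 assms by (simp add: kernel_0)
next
  case (Suc n)
  have diff: "F W V (Suc n) x x - F W V (Suc n) x \<xi> = kernel 0 (Suc n) x \<xi>" if "0 \<le> \<xi>" "\<xi> \<le> s" for \<xi>
    using Suc.IH[of x] Suc.IH[of \<xi>] Suc.prems that kernel_Suc_eq_diff[of \<xi> x 0 n] by simp
  have "F W V (Suc (Suc n)) x s = (if even (Suc n) then LINT \<xi>:{0<..s}|dW W. kernel 0 (Suc n) x \<xi>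
      else LINT \<xi>:{0..<s}|dV V. kernel 0 (Suc n) x \<xi>)"
    unfolding F.simps(3) set_lebesgue_integral_def using diff
    by (auto intro!: Bochner_Integration.integral_cong simp: indicator_def simp del: F.simps kernel.simps)
  then show ?case
    using integral_before[OF measurable_kernel, of "Suc n" s 0 "Suc n" x] Suc.prems assms(1)
    by (simp del: F.simps kernel.simps)
qed

lemma G_eq_integral_kernel:
  assumes "x \<le> 1" "0 \<le> s" "s \<le> x"
  shows "G W V (Suc n) x s = (\<integral>\<xi>. of_bool (before (Suc n) \<xi> s) * kernel 1 n x \<xi> \<partial>\<mu> (Suc n))"
  using assms(2,3)
proof (induction n arbitrary: s)
  case 0
  have "(LINT \<xi>:{0..<s}|dV V. (1::real)) = V s"
    using emeasure_dV_Ico[OF V_mono V_caglad, of 0 s] V_mono 0 V_0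
    by (simp add: set_lebesgue_integral_def measure_def strict_mono_less_eq[of V 0 s, simplified V_0])
  then show ?case
    using integral_before[OF measurable_kernel, of "Suc 0" s 1 0 x] 0 assms by (simp add: kernel_0)
next
  case (Suc n)
  have diff: "G W V (Suc n) x x - G W V (Suc n) x \<xi> = kernel 1 (Suc n) x \<xi>" if "0 \<le> \<xi>" "\<xi> \<le> s" for \<xi>
    using Suc.IH[of x] Suc.IH[of \<xi>] Suc.prems that kernel_Suc_eq_diff[of \<xi> x 1 n] by simp
  have "G W V (Suc (Suc n)) x s = (if even (Suc (Suc n)) then LINT \<xi>:{0<..s}|dW W. kernel 1 (Suc n) x \<xi>
      else LINT \<xi>:{0..<s}|dV V. kernel 1 (Suc n) x \<xi>)"
    unfolding G.simps(3) set_lebesgue_integral_def using diff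
    by (auto intro!: Bochner_Integration.integral_cong simp: indicator_def simp del: G.simps kernel.simps)
  then show ?case
    using integral_before[OF measurable_kernel, of "Suc (Suc n)" s 1 "Suc n" x] Suc.prems assms(1)
    by (simp del: G.simps kernel.simps)
qed

lemma iter_eq_F:
  assumes "even m" "0 \<le> x" "x \<le> 1"
  shows "iter m (Suc k) (\<lambda>_. 1) x = F W V (Suc k) x x"
  using F_eq_integral_kernel[of x x k] iter_eq_kernel[of "\<lambda>_. 1" 0 k x] iter_parity[of m 0] assms
  by (simp del: iter.simps F.simps)

lemma iter_eq_G:
  assumes "odd m" "0 \<le> x" "x \<le> 1"
  shows "iter m (Suc k) (\<lambda>_. 1) x = G W V (Suc k) x x"
  using G_eq_integral_kernel[of x x k] iter_eq_kernel[of "\<lambda>_. 1" 1 k x] iter_parity[of m 1] assms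
  by (simp del: iter.simps G.simps)

text \<open>Membership of \<open>C_infinity\<close> provides exactly the one-sided continuity needed in the
  fundamental theorem. The relation extends from the unit interval to all \<open>x\<close> since both sides are constant
  beyond its endpoints.\<close>

lemma D_ftc:
  assumes f: "f \<in> C_infinity W V" and bnd: "\<And>n x. x \<in> {0..1} \<Longrightarrow> \<bar>D W V n f x\<bar> \<le> B n"
  defines "d \<equiv> \<lambda>n x. D W V n f (clamp01 x)"
  shows "bounded_borel (d n)" and "d n x = d n 0 + step n (d (Suc n)) x"
proof -
  obtain a b where ab: "a < 0" "1 < b"
    and der: "\<And>n x. x \<in> {a<..<b} \<Longrightarrow> if even n then \<exists>d. has_left_deriv W (D W V n f) x d
        else \<exists>d. has_right_deriv V (D W V n f) x d"
    and reg: "\<And>n. if even n then cadlag_on {a<..<b} (D W V n f) else caglad_on {a<..<b} (D W V n f)"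
    using f unfolding C_infinity_def by blast
  have left: "has_left_deriv W (D W V n f) x (D W V (Suc n) f x)" if "even n" "0 \<le> x" "x \<le> 1" for n x
    using der[of x n] that ab left_deriv_eq by fastforce
  have right: "has_right_deriv V (D W V n f) x (D W V (Suc n) f x)" if "odd n" "0 \<le> x" "x \<le> 1" for n x
    using der[of x n] that ab right_deriv_eq by fastforce
  have rc: "continuous (at_right x) (D W V n f)" if "even n" "0 \<le> x" "x \<le> 1" for n x
    using reg[of n] that ab by (auto simp: cadlag_on_def)
  have lc: "continuous (at_left x) (D W V n f)" if "odd n" "0 \<le> x" "x \<le> 1" for n x
    using reg[of n] that ab by (auto simp: caglad_on_def)
  have rcd: "continuous (at_right x) (d n)" if "even n" for n x
    unfolding d_def by (rule continuous_at_right_clamp01) (use rc that in auto)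
  have lcd: "continuous (at_left x) (d n)" if "odd n" for n x
    unfolding d_def by (rule continuous_at_left_clamp01) (use lc that in auto)
  have meas: "d n \<in> borel_measurable borel" for n
    using borel_measurable_right_continuous[OF rcd] borel_measurable_left_continuous[OF lcd] by blast
  have dB: "\<bar>d n x\<bar> \<le> B n" for n x unfolding d_def by (rule bnd) simp
  show "bounded_borel (d n)" using meas dB unfolding bounded_borel_def by blast
  let ?x = "clamp01 x"
  have x1: "?x \<le> 1" by simp
  have "D W V n f ?x - D W V n f 0 = step n (d (Suc n)) x"
  proof (cases "even n")
    case True
    have "D W V n f ?x - D W V n f 0 = (LINT \<xi>:{0<..?x}|interval_measure W. d (Suc n) \<xi>)"
    proof (rule ftc_left_deriv[OF W_mono _ _ meas dB])
      show "continuous (at_right x) W" for x using W_cadlag by (simp add: cadlag_on_def)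
      show "continuous (at_right y) (D W V n f)" if "0 \<le> y" "y < ?x" for y
        using that x1 by (intro rc True) linarith+
      show "continuous (at_left y) (d (Suc n))" for y by (rule lcd) (simp add: True)
      show "has_left_deriv W (D W V n f) y (d (Suc n) y)" if "0 < y" "y \<le> ?x" for y
        using left[OF True, of y] order_trans[OF that(2) x1] that(1) by (simp add: d_def del: D.simps)
    qed simp
    then show ?thesis using True by (simp add: step_eq[OF meas] dW_def)
  next
    case False
    have "D W V n f ?x - D W V n f 0 = (LINT \<xi>:{0..<?x}|dV V. d (Suc n) \<xi>)"
    proof (rule ftc_right_deriv[OF V_mono _ _ meas dB])
      show "continuous (at_left x) V" for x using V_caglad by (simp add: caglad_on_def)
      show "continuous (at_left y) (D W V n f)" if "0 < y" "y \<le> ?x" for y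
        using that x1 by (intro lc False) linarith+
      show "continuous (at_right y) (d (Suc n))" for y by (rule rcd) (simp add: False)
      show "has_right_deriv V (D W V n f) y (d (Suc n) y)" if "0 \<le> y" "y < ?x" for y
        using right[OF False, of y] order_trans[OF less_imp_le[OF that(2)] x1] that(1) by (simp add: d_def del: D.simps)
    qed simp
    then show ?thesis using False by (simp add: step_eq[OF meas])
  qed
  then show "d n x = d n 0 + step n (d (Suc n)) x" by (simp add: d_def del: D.simps)
qed

end

theorem theorem12:
  fixes W V f :: "real \<Rightarrow> real" and c :: "nat \<Rightarrow> real"
  assumes "strict_mono W" and "strict_mono V"
    and "cadlag_on UNIV W" and "caglad_on UNIV V"
    and "\<And>x. W (x + 1) - W x = W 1 - W 0"
    and "\<And>x. V (x + 1) - V x = V 1 - V 0"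
    and "isCont W 0" and "isCont V 0" and "W 0 = 0" and "V 0 = 0"
    and "f \<in> C_infinity W V"
    and "\<And>n. max (sup_norm (D W V (2 * n) f)) (sup_norm (D W V (2 * n + 1) f)) \<le> ereal (c n)"
    and "c \<in> o(\<lambda>n. fact n / exp (real n))"
  shows "(\<forall>x\<in>{0..1}. f x = f 0 + (\<Sum>k. D W V (Suc k) f 0 * F W V (Suc k) x x)) \<and>
    uniform_limit {0..1} (\<lambda>N x. \<Sum>k<N. D W V (Suc k) f 0 * F W V (Suc k) x x)
      (\<lambda>x. \<Sum>k. D W V (Suc k) f 0 * F W V (Suc k) x x) sequentially \<and>
    ((\<forall>n. D W V n f 0 = D W V n f 1) \<longrightarrow>
      (\<forall>m. even m \<longrightarrow> (\<lambda>k. D W V (Suc k + m) f 0 * F W V (Suc k) 1 1) sums 0) \<and>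
      (\<forall>m. odd m \<longrightarrow> (\<lambda>k. D W V (Suc k + m) f 0 * G W V (Suc k) 1 1) sums 0))"
proof -
  interpret stieltjes_pair W V
    by (rule stieltjes_pair.intro) (rule assms)+
  have Dc: "\<bar>D W V n f x\<bar> \<le> c (n div 2)" if "x \<in> {0..1}" for n x
  proof -
    have "sup_norm (D W V n f) \<le> ereal (c (n div 2))"
      using assms(12)[of "n div 2"]
      by (cases "even n") (auto simp: odd_two_times_div_two_succ simp del: D.simps)
    moreover have "ereal \<bar>D W V n f x\<bar> \<le> sup_norm (D W V n f)"
      unfolding sup_norm_def by (rule SUP_upper[OF that])
    ultimately have "ereal \<bar>D W V n f x\<bar> \<le> ereal (c (n div 2))"
      by (rule order_trans[rotated])
    then show ?thesis by simp
  qed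
  define d where "d n x = D W V n f (clamp01 x)" for n x
  have d_borel: "bounded_borel (d n)" for n
    unfolding d_def using D_ftc(1)[OF assms(11), of "\<lambda>n. c (n div 2)"] Dc by simp
  have d_ftc: "d n x = d n 0 + step n (d (Suc n)) x" for n x
    unfolding d_def using D_ftc(2)[OF assms(11), of "\<lambda>n. c (n div 2)"] Dc by blast
  have d_c: "\<bar>d n x\<bar> \<le> c (n div 2)" for n x
    unfolding d_def by (rule Dc) simp
  have d_eq: "d n x = D W V n f x" if "0 \<le> x" "x \<le> 1" for n x
    using that by (simp add: d_def)
  have "eventually (\<lambda>n. norm (c n) \<le> 1 * norm (fact n / exp (real n))) sequentially"
    by (rule landau_o.smallD[OF assms(13)]) simp
  then have c_fact: "eventually (\<lambda>n. c n \<le> fact n) sequentially"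
  proof eventually_elim
    case (elim n)
    have "fact n / exp (real n) \<le> fact n / 1" by (intro divide_left_mono) auto
    then show ?case using elim by simp
  qed
  note remainder = iter_remainder_tendsto_0[OF d_borel d_c c_fact]
  note partial = taylor_partial_sum[OF d_borel d_ftc]
  have sums: "(\<lambda>k. D W V (Suc k + m) f 0 * iter m (Suc k) (\<lambda>_. 1) x) sums (D W V m f x - D W V m f 0)"
    if x: "0 \<le> x" "x \<le> 1" for m x
  proof -
    obtain r where r: "r \<longlonglongrightarrow> 0"
      and le: "\<forall>\<^sub>F N in sequentially. \<forall>x. \<bar>iter m (Suc N) (d (m + Suc N)) x\<bar> \<le> r N"
      using remainder[of m] by blast
    have "(\<lambda>N. iter m (Suc N) (d (m + Suc N)) x) \<longlonglongrightarrow> 0"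
      by (rule Lim_null_comparison[OF _ r]) (use le in eventually_elim, simp)
    then have "(\<lambda>N. d m x - d m 0 - iter m (Suc N) (d (m + Suc N)) x) \<longlonglongrightarrow> d m x - d m 0 - 0"
      by (intro tendsto_intros)
    then show ?thesis
      unfolding sums_def partial[symmetric] using x by (simp add: d_eq del: iter.simps D.simps)
  qed
  have sumsF: "(\<lambda>k. D W V (Suc k) f 0 * F W V (Suc k) x x) sums (f x - f 0)" if "x \<in> {0..1}" for x
    using sums[of x 0] that by (simp add: iter_eq_F del: iter.simps D.simps(2) F.simps)
  have "uniform_limit {0..1} (\<lambda>N x. \<Sum>k<N. D W V (Suc k) f 0 * F W V (Suc k) x x)
      (\<lambda>x. \<Sum>k. D W V (Suc k) f 0 * F W V (Suc k) x x) sequentially"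
  proof (rule uniform_limitI)
    fix e :: real assume "0 < e"
    obtain r where r: "r \<longlonglongrightarrow> 0"
      and le: "\<forall>\<^sub>F N in sequentially. \<forall>x. \<bar>iter 0 (Suc N) (d (0 + Suc N)) x\<bar> \<le> r N"
      using remainder[of 0] by blast
    show "\<forall>\<^sub>F N in sequentially. \<forall>x\<in>{0..1}. dist (\<Sum>k<N. D W V (Suc k) f 0 * F W V (Suc k) x x)
        (\<Sum>k. D W V (Suc k) f 0 * F W V (Suc k) x x) < e"
      using le order_tendstoD(2)[OF r \<open>0 < e\<close>]
    proof eventually_elim
      case (elim N)
      show ?case
      proof
        fix x :: real assume x: "x \<in> {0..1}"
        have "(\<Sum>k<N. D W V (Suc k) f 0 * F W V (Suc k) x x) = f x - f 0 - iter 0 (Suc N) (d (Suc N)) x"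
          using partial[of 0 x N] x by (simp add: d_eq iter_eq_F del: iter.simps D.simps(2) F.simps)
        then show "dist (\<Sum>k<N. D W V (Suc k) f 0 * F W V (Suc k) x x)
            (\<Sum>k. D W V (Suc k) f 0 * F W V (Suc k) x x) < e"
          using elim(1)[rule_format, of x] elim(2) sums_unique[OF sumsF[OF x]]
          by (simp add: dist_real_def del: iter.simps D.simps F.simps)
      qed
    qed
  qed
  moreover have "f x = f 0 + (\<Sum>k. D W V (Suc k) f 0 * F W V (Suc k) x x)" if "x \<in> {0..1}" for x
    using sums_unique[OF sumsF[OF that]] by simp
  moreover have "(\<lambda>k. D W V (Suc k + m) f 0 * F W V (Suc k) 1 1) sums 0"
    if "\<forall>n. D W V n f 0 = D W V n f 1" "even m" for m
    using sums[of 1 m] that(1)[rule_format, of m] that(2) by (simp add: iter_eq_F del: iter.simps D.simps F.simps)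
  moreover have "(\<lambda>k. D W V (Suc k + m) f 0 * G W V (Suc k) 1 1) sums 0"
    if "\<forall>n. D W V n f 0 = D W V n f 1" "odd m" for m
    using sums[of 1 m] that(1)[rule_format, of m] that(2) by (simp add: iter_eq_G del: iter.simps D.simps G.simps)
  ultimately show ?thesis by blast
qed

end
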